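(* Let $\alpha:\mathbb{R}\to[c,d]\subset(0,2)$ and $H:\mathbb{R}\to(0,1)$ be continuously differentiable and such that $H-\frac1\alpha$ is a non-negative function on $\mathbb{R}$. Let $Y$ be the linear multistable multifractional motion on $\mathbb{R}$ with parameters $\alpha,H$, as defined in the context. Then for all $t\in\mathbb{R}$, almost surely, $\mathcal{H}_t\le H(t)$, where $$\mathcal{H}_t=\sup\Big\{\gamma:\lim_{r\to0}\frac{|Y(t+r)-Y(t)|}{|r|^\gamma}=0\Big\}$$ is the pointwise Hölder exponent of $Y$ at $t$.
   Context: Linear multistable multifractional motion: let $(\Gamma_i)_{i\ge1}$ be the arrival times of a Poisson process with unit rate, $(V_i)_{i\ge1}$ i.i.d. with distribution $\hat m(dx)=\frac{3}{\pi^2}\sum_{j=1}^{\infty}j^{-2}\mathbf{1}_{[-j,-j+1)\cup[j-1,j)}(x)\,dx$ on $\mathbb{R}$, and $(\gamma_i)_{i\ge1}$ i.i.d. with $P(\gamma_i=1)=P(\gamma_i=-1)=1/2$, the three sequences being independent. With $C_\eta=\big(\int_0^\infty x^{-\eta}\sin x\,dx\big)^{-1}$, set $$X(t,u)=C_{\alpha(u)}^{1/\alpha(u)}\sum_{i,j=1}^{\infty}\Big(\frac{\pi^2j^2}{3}\Big)^{1/\alpha(u)}\gamma_i\Gamma_i^{-1/\alpha(u)}\Big(|t-V_i|^{H(u)-1/\alpha(u)}-|V_i|^{H(u)-1/\alpha(u)}\Big)\mathbf{1}_{[-j,-j+1)\cup[j-1,j)}(V_i),$$ and $Y(t)=X(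t,t)$.
   Formalization: Where H(u) = 1/α(u), the powers |t−V_i|^0 and |V_i|^0 are read with 0^0 = 0; with 0^0 = 1 the claim fails (for constant H = 1/α, Y vanishes identically and its exponent is +∞). Nothing changes when H > 1/α almost everywhere. *)

theory Defs
  imports "HOL-Probability.Probability"
begin

definition pointwise_holder_exponent :: "(real \<Rightarrow> real) \<Rightarrow> real \<Rightarrow> ereal" where
  "pointwise_holder_exponent f t =
     (SUP \<gamma>\<in>{\<gamma>. ((\<lambda>r. \<bar>f (t + r) - f t\<bar> / \<bar>r\<bar> powr \<gamma>) \<longlongrightarrow> 0) (at 0)}. ereal \<gamma>)"

definition (in prob_space) poisson_process :: "real \<Rightarrow> (real \<Rightarrow> 'a \<Rightarrow> nat) \<Rightarrow> bool" where
  "poisson_process rate N \<longleftrightarrow>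
     (\<forall>t\<ge>0. random_variable (count_space UNIV) (N t)) \<and>
     (\<forall>\<omega>\<in>space M. N 0 \<omega> = 0 \<and> mono_on {0..} (\<lambda>t. N t \<omega>) \<and>
        (\<forall>t\<ge>0. continuous (at_right t) (\<lambda>s. N s \<omega>))) \<and>
     (\<forall>(\<tau> :: nat \<Rightarrow> real) n. 0 \<le> \<tau> 0 \<longrightarrow> incseq \<tau> \<longrightarrow>
        indep_vars (\<lambda>_. count_space UNIV) (\<lambda>k \<omega>. N (\<tau> (Suc k)) \<omega> - N (\<tau> k) \<omega>) {..<n}) \<and>
     (\<forall>s t. 0 \<le> s \<longrightarrow> s < t \<longrightarrow>
        distr M (count_space UNIV) (\<lambda>\<omega>. N t \<omega> - N s \<omega>)
          = measure_pmf (poisson_pmf (rate * (t - s))))"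

text \<open>
  The random sequences below are indexed from 0: the entry with index \<open>i\<close> is the one
  usually numbered \<open>i + 1\<close>.  In particular \<open>arrival_time N i\<close> is the time of the
  \<open>(i + 1)\<close>-st arrival.
\<close>

definition arrival_time :: "(real \<Rightarrow> 'a \<Rightarrow> nat) \<Rightarrow> nat \<Rightarrow> 'a \<Rightarrow> real" where
  "arrival_time N i \<omega> = Inf {t. 0 \<le> t \<and> Suc i \<le> N t \<omega>}"

definition unit_shell :: "nat \<Rightarrow> real set" where
  "unit_shell j = {- real j..<- real j + 1} \<union> {real j - 1..<real j}"

definition m_hat_density :: "real \<Rightarrow> real" where
  "m_hat_density x = 3 / pi\<^sup>2 * (\<Sum>j. 1 / (real (Suc j))\<^sup>2 * indicator (unit_shell (Suc j)) x)"

text \<open>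
  The gauge integral over the half-line includes the conditionally convergent improper
  integral, so this is the intended constant for all \<open>0 < \<eta> < 2\<close>.
\<close>

definition stable_const :: "real \<Rightarrow> real" where
  "stable_const \<eta> = inverse (integral {0..} (\<lambda>x. x powr (- \<eta>) * sin x))"

text \<open>
  The double series is summed over \<open>j\<close> first: for each \<open>i\<close> at most one \<open>j\<close> contributes, while
  the series over \<open>i\<close> converges only conditionally in general.  Where \<open>H u = 1 / \<alpha> u\<close>, the
  kernel involves \<open>0 powr 0\<close>, which is \<open>0\<close>.
\<close>

definition lmmm_field ::
  "(real \<Rightarrow> real) \<Rightarrow> (real \<Rightarrow> real) \<Rightarrow> (nat \<Rightarrow> 'a \<Rightarrow> real) \<Rightarrow> (nat \<Rightarrow> 'a \<Rightarrow> real) \<Rightarrow>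
    (nat \<Rightarrow> 'a \<Rightarrow> real) \<Rightarrow> real \<Rightarrow> real \<Rightarrow> 'a \<Rightarrow> real" where
  "lmmm_field \<alpha> H \<Gamma> V \<gamma> t u \<omega> =
     stable_const (\<alpha> u) powr (1 / \<alpha> u) *
     (\<Sum>i. \<Sum>j. (pi\<^sup>2 * (real (Suc j))\<^sup>2 / 3) powr (1 / \<alpha> u) * \<gamma> i \<omega> * \<Gamma> i \<omega> powr (- 1 / \<alpha> u) *
        (\<bar>t - V i \<omega>\<bar> powr (H u - 1 / \<alpha> u) - \<bar>V i \<omega>\<bar> powr (H u - 1 / \<alpha> u)) *
        indicator (unit_shell (Suc j)) (V i \<omega>))"

definition lmmm ::
  "(real \<Rightarrow> real) \<Rightarrow> (real \<Rightarrow> real) \<Rightarrow> (nat \<Rightarrow> 'a \<Rightarrow> real) \<Rightarrow> (nat \<Rightarrow> 'a \<Rightarrow> real) \<Rightarrow>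
    (nat \<Rightarrow> 'a \<Rightarrow> real) \<Rightarrow> real \<Rightarrow> 'a \<Rightarrow> real" where
  "lmmm \<alpha> H \<Gamma> V \<gamma> t \<omega> = lmmm_field \<alpha> H \<Gamma> V \<gamma> t t \<omega>"

definition (in prob_space) lmmm_driving_sequences ::
  "(nat \<Rightarrow> 'a \<Rightarrow> real) \<Rightarrow> (nat \<Rightarrow> 'a \<Rightarrow> real) \<Rightarrow> (nat \<Rightarrow> 'a \<Rightarrow> real) \<Rightarrow> bool" where
  "lmmm_driving_sequences \<Gamma> V \<gamma> \<longleftrightarrow>
     (\<exists>N. poisson_process 1 N \<and> \<Gamma> = arrival_time N) \<and>
     indep_vars (\<lambda>_. borel) V UNIV \<and>
     (\<forall>i. distributed M lborel (V i) (\<lambda>x. ennreal (m_hat_density x))) \<and>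
     indep_vars (\<lambda>_. borel) \<gamma> UNIV \<and>
     (\<forall>i. prob {\<omega> \<in> space M. \<gamma> i \<omega> = 1} = 1 / 2 \<and> prob {\<omega> \<in> space M. \<gamma> i \<omega> = - 1} = 1 / 2) \<and>
     indep_vars (\<lambda>_. \<Pi>\<^sub>M i\<in>UNIV. borel)
       (\<lambda>k \<omega>. ([\<lambda>i. \<Gamma> i \<omega>, \<lambda>i. V i \<omega>, \<lambda>i. \<gamma> i \<omega>] ! k)) {..<3}"

end

theory Submission
  imports Defs
begin

text \<open>
  The hypothesis forces \<open>1 < \<alpha> < 2\<close>.  Conditionally on the arrival times and the \<open>V\<^sub>i\<close>, the process
  is a Rademacher series \<open>Y s = (\<Sum>k. \<gamma>\<^sub>k * c\<^sub>k s)\<close>, so each sign can be flipped without changing its law.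
  Almost surely infinitely many \<open>i\<close> satisfy \<open>r = \<bar>V\<^sub>i - t\<bar> \<le> 1 / (i + 1)\<close>, and for them we look at the
  increment \<open>Y V\<^sub>i - Y t\<close>.  At \<open>s = V\<^sub>i\<close> the singular factor of the \<open>i\<close>-th term vanishes (even for exponent
  0), hence this term alone contributes \<open>\<plusminus>(c\<^sub>i V\<^sub>i - c\<^sub>i t)\<close>, of order
  \<open>\<Gamma>\<^sub>i powr (- 1 / \<alpha> t) * r powr (H t - 1 / \<alpha> t)\<close>, which is at least of order \<open>r powr H t\<close> and exceeds
  \<open>r powr \<gamma>\<close> for every \<open>\<gamma> > H t\<close>.  Flipping its sign shows that the increment exceeds \<open>r powr \<gamma>\<close>
  with conditional probability at least one half.  Every fixed \<open>c\<^sub>k\<close> is Lipschitz at \<open>t\<close>,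
  so for \<open>\<gamma> < 1\<close> the event that the increments are \<open>o(r powr \<gamma>)\<close> is a tail event of the signs, and
  the 0-1 law makes it null.
\<close>

section \<open>Rademacher series\<close>

text \<open>The bound \<open>1 < \<alpha> u\<close> comes from
  \<open>1 / \<alpha> u \<le> H u < 1\<close>. The evaluation points \<open>V\<^sub>i\<close> are
  random, but they depend only on what is conditioned upon: once arrival times and locations are
  frozen, what remains is a deterministic array of square summable rows combined with fair signs.
  Only the diagonal entry of a row has to be large. Flipping one sign needs no estimate of the other
  terms, so no bound uniform in \<open>s\<close> enters. The threshold \<open>1 / (i + 1)\<close> is
  a balance. Its sum diverges, so independent locations with density bounded below near
  \<open>t\<close> meet it infinitely often. It is also at most a multiple of
  \<open>1 / \<Gamma>\<^sub>i\<close>, so \<open>\<Gamma>\<^sub>i powr (- 1 / \<alpha> t)\<close> is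
  at least a multiple of \<open>r powr (1 / \<alpha> t)\<close>, which completes the exponent
  \<open>H t - 1 / \<alpha> t\<close> to \<open>H t\<close>. Two analytic obstacles remain: the
  factor \<open>stable_const (\<alpha> s)\<close> varies with \<open>s\<close>, so its positivity
  and regularity must be established, and the locations have density of order
  \<open>x powr (- 2)\<close> at infinity, too heavy for a direct second moment argument.\<close>

definition coin :: "real measure" where
  "coin = distr (measure_pmf (pmf_of_set {1, - 1})) borel (\<lambda>x. x)"

lemma sets_coin [simp, measurable_cong]: "sets coin = sets borel"
  by (simp add: coin_def)

lemma space_coin [simp]: "space coin = UNIV"
  by (simp add: coin_def)

lemma nn_integral_coin:
  assumes [measurable]: "f \<in> borel_measurable borel"
  shows "(\<integral>\<^sup>+x. f x \<partial>coin) = (f 1 + f (- 1)) / 2"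
  by (simp add: coin_def nn_integral_distr nn_integral_pmf_of_set)

lemma emeasure_coin:
  assumes "A \<in> sets borel"
  shows "emeasure coin A = (indicator A 1 + indicator A (- 1)) / 2"
  using assms nn_integral_coin[of "indicator A"] by (simp add: nn_integral_indicator)

lemma prob_space_coin: "prob_space coin"
  by (rule prob_spaceI) (simp add: emeasure_coin ennreal_divide_self)

global_interpretation coin: sequence_space coin
  by (intro sequence_space.intro product_prob_spaceI prob_space_coin)

abbreviation coins :: "(nat \<Rightarrow> real) measure" where
  "coins \<equiv> \<Pi>\<^sub>M i\<in>UNIV. coin"

lemma space_coins [simp]: "space coins = UNIV"
  by (simp add: space_PiM)

lemma measurable_coins_borel [simp]: "measurable coins N = measurable (\<Pi>\<^sub>M i\<in>UNIV. borel) N"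
  by (rule measurable_cong_sets) (auto intro!: sets_PiM_cong)

lemma sets_coins: "sets coins = sets (\<Pi>\<^sub>M i\<in>UNIV. borel)"
  by (intro sets_PiM_cong) auto

text \<open>Conditioning on the first coin: prepending an independent coin to a coin sequence
  reproduces the product measure (\<open>coin.PiM_iter\<close>), and Fubini integrates the first
  coordinate out.\<close>

lemma emeasure_coins_iter:
  assumes A [measurable]: "Measurable.pred (\<Pi>\<^sub>M i\<in>UNIV. borel) P"
  shows "emeasure coins {\<omega>. P \<omega>} =
    (emeasure coins {\<omega>. P (case_nat 1 \<omega>)} + emeasure coins {\<omega>. P (case_nat (- 1) \<omega>)}) / 2"
proof -
  have m [measurable]: "(\<lambda>(s, \<omega>). case_nat s \<omega>) \<in> coin \<Otimes>\<^sub>M coins \<rightarrow>\<^sub>M coins"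
    by measurable
  have [measurable]: "Measurable.pred coins P"
    using A by simp
  have [measurable]: "Measurable.pred (coin \<Otimes>\<^sub>M coins) (\<lambda>z. P (case_nat (fst z) (snd z)))"
    by measurable
  have P [measurable]: "{\<omega>. P \<omega>} \<in> sets coins"
    using predE[OF \<open>Measurable.pred coins P\<close>] by simp
  have "emeasure coins {\<omega>. P \<omega>} = (\<integral>\<^sup>+\<omega>. indicator {\<omega>. P \<omega>} \<omega> \<partial>coins)"
    by (rule nn_integral_indicator[symmetric]) measurable
  also have "\<dots> = (\<integral>\<^sup>+\<omega>. indicator {\<omega>. P \<omega>} \<omega> \<partial>distr (coin \<Otimes>\<^sub>M coins) coins (\<lambda>(s, \<omega>). case_nat s \<omega>))"
    by (simp only: coin.PiM_iter)
  also have "\<dots> = (\<integral>\<^sup>+z. indicator {\<omega>. P \<omega>} (case_nat (fst z) (snd z)) \<partial>(coin \<Otimes>\<^sub>M coins))"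
    by (subst nn_integral_distr) (auto simp: split_beta' intro!: measurable_compose[OF _ borel_measurable_indicator])
  also have "\<dots> = (\<integral>\<^sup>+s. \<integral>\<^sup>+\<omega>. indicator {\<omega>. P \<omega>} (case_nat s \<omega>) \<partial>coins \<partial>coin)"
    by (subst coin.P.nn_integral_fst[symmetric]) auto
  also have "\<dots> = (\<integral>\<^sup>+s. emeasure coins {\<omega>. P (case_nat s \<omega>)} \<partial>coin)"
  proof (rule nn_integral_cong)
    fix s :: real
    have "{\<omega> \<in> space coins. P (case_nat s \<omega>)} \<in> sets coins"
      by measurable
    then have "emeasure coins {\<omega>. P (case_nat s \<omega>)} = (\<integral>\<^sup>+\<omega>. indicator {\<omega>. P (case_nat s \<omega>)} \<omega> \<partial>coins)"
      by simp
    then show "(\<integral>\<^sup>+\<omega>. indicator {\<omega>. P \<omega>} (case_nat s \<omega>) \<partial>coins) = emeasure coins {\<omega>. P (case_nat s \<omega>)}"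
      by (simp add: indicator_def)
  qed
  also have "\<dots> = (emeasure coins {\<omega>. P (case_nat 1 \<omega>)} + emeasure coins {\<omega>. P (case_nat (- 1) \<omega>)}) / 2"
  proof (rule nn_integral_coin)
    have "(\<lambda>s. emeasure coins {\<omega> \<in> space coins. P (case_nat s \<omega>)}) \<in> borel_measurable coin"
      by measurable
    thus "(\<lambda>s. emeasure coins {\<omega>. P (case_nat s \<omega>)}) \<in> borel_measurable borel"
      by (simp add: measurable_cong_sets[OF sets_coin refl])
  qed
  finally show ?thesis .
qed

lemma ennreal_half_add: "0 \<le> p \<Longrightarrow> 0 \<le> q \<Longrightarrow> (ennreal p + ennreal q) / 2 = ennreal ((p + q) / 2)"
  by (metis add_nonneg_nonneg divide_ennreal ennreal_numeral ennreal_plus zero_le_numeral zero_less_numeral)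

text \<open>The starting point \<open>x\<close> is what makes the induction on the first coin go through.\<close>

lemma coins_maximal_inequality:
  fixes a :: "nat \<Rightarrow> real"
  assumes l: "0 < l"
  shows "emeasure coins {\<omega>. \<exists>k\<le>n. l \<le> \<bar>x + (\<Sum>i<k. \<omega> i * a i)\<bar>} \<le> ennreal ((x\<^sup>2 + (\<Sum>i<n. (a i)\<^sup>2)) / l\<^sup>2)"
proof (induction n arbitrary: x a)
  case (0 x a)
  show ?case
  proof (cases "l \<le> \<bar>x\<bar>")
    case True
    then have "1 \<le> x\<^sup>2 / l\<^sup>2"
      using l abs_le_square_iff[of l x] by simp
    then have "1 \<le> ennreal (x\<^sup>2 / l\<^sup>2)"
      using ennreal_leI by fastforce
    then show ?thesis
      using True coin.P.emeasure_space_1 by simp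
  qed simp
next
  case (Suc n x a)
  let ?E = "{\<omega>. \<exists>k\<le>Suc n. l \<le> \<bar>x + (\<Sum>i<k. \<omega> i * a i)\<bar>}"
  let ?R = "\<Sum>i<n. (a (Suc i))\<^sup>2"
  show ?case
  proof (cases "l \<le> \<bar>x\<bar>")
    case True
    then have "l\<^sup>2 \<le> x\<^sup>2"
      using l by (simp flip: abs_le_square_iff)
    also have "\<dots> \<le> x\<^sup>2 + (\<Sum>i<Suc n. (a i)\<^sup>2)"
      by (simp add: sum_nonneg del: sum.lessThan_Suc)
    finally have "1 \<le> (x\<^sup>2 + (\<Sum>i<Suc n. (a i)\<^sup>2)) / l\<^sup>2"
      using l by simp
    then have "1 \<le> ennreal ((x\<^sup>2 + (\<Sum>i<Suc n. (a i)\<^sup>2)) / l\<^sup>2)"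
      using ennreal_leI by fastforce
    then show ?thesis
      using coin.P.emeasure_le_1[of ?E] by (rule order_trans[rotated])
  next
    case False
    have [measurable]: "Measurable.pred (\<Pi>\<^sub>M i\<in>UNIV. borel) (\<lambda>\<omega>. \<exists>k\<le>Suc n. l \<le> \<bar>x + (\<Sum>i<k. \<omega> i * a i)\<bar>)"
      by measurable
    \<comment> \<open>The index \<open>k = 0\<close> does not reach \<open>l\<close>, so the first
      coin can be absorbed into the starting point and all other indices shift down by one.\<close>
    have *: "(\<exists>k\<le>Suc n. l \<le> \<bar>x + (\<Sum>i<k. case_nat s \<omega> i * a i)\<bar>) \<longleftrightarrow>
      (\<exists>k\<le>n. l \<le> \<bar>(x + s * a 0) + (\<Sum>i<k. \<omega> i * a (Suc i))\<bar>)" (is "(\<exists>k\<le>_. ?p k) \<longleftrightarrow> (\<exists>k\<le>_. ?q k)") for s \<omega>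
    proof -
      have "?p (Suc k) = ?q k" for k
        by (simp only: sum.lessThan_Suc_shift add.assoc nat.case)
      moreover have "\<not> ?p 0"
        using False by simp
      moreover have "(\<exists>k\<le>Suc n. R k) \<longleftrightarrow> R 0 \<or> (\<exists>k\<le>n. R (Suc k))" for R
      proof
        assume "\<exists>k\<le>Suc n. R k"
        then obtain k where "k \<le> Suc n" "R k"
          by blast
        then show "R 0 \<or> (\<exists>k\<le>n. R (Suc k))"
          by (cases k) auto
      qed auto
      ultimately show ?thesis
        by simp
    qed
    have "emeasure coins ?E =
       (emeasure coins {\<omega>. \<exists>k\<le>n. l \<le> \<bar>(x + 1 * a 0) + (\<Sum>i<k. \<omega> i * a (Suc i))\<bar>} +
        emeasure coins {\<omega>. \<exists>k\<le>n. l \<le> \<bar>(x + (- 1) * a 0) + (\<Sum>i<k. \<omega> i * a (Suc i))\<bar>}) / 2"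
      unfolding *[symmetric] by (rule emeasure_coins_iter) measurable
    also have "\<dots> \<le> (ennreal (((x + 1 * a 0)\<^sup>2 + ?R) / l\<^sup>2) + ennreal (((x + (- 1) * a 0)\<^sup>2 + ?R) / l\<^sup>2)) / 2"
      by (intro divide_right_mono_ennreal add_mono Suc.IH)
    also have "\<dots> = ennreal ((((x + 1 * a 0)\<^sup>2 + ?R) / l\<^sup>2 + ((x + (- 1) * a 0)\<^sup>2 + ?R) / l\<^sup>2) / 2)"
      by (rule ennreal_half_add) (simp_all add: sum_nonneg)
    \<comment> \<open>Averaging over the two signs cancels the cross terms
      \<open>2 * x * a 0\<close>.\<close>
    also have "(((x + 1 * a 0)\<^sup>2 + ?R) / l\<^sup>2 + ((x + (- 1) * a 0)\<^sup>2 + ?R) / l\<^sup>2) / 2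
      = (x\<^sup>2 + ((a 0)\<^sup>2 + ?R)) / l\<^sup>2"
      by (simp add: power2_eq_square algebra_simps add_divide_distrib diff_divide_distrib)
    also have "(a 0)\<^sup>2 + ?R = (\<Sum>i<Suc n. (a i)\<^sup>2)"
      by (simp only: sum.lessThan_Suc_shift)
    finally show ?thesis .
  qed
qed

text \<open>The maximal inequality, applied to the tail from \<open>m\<close> on, bounds the
  probability that the tail ever exceeds \<open>e\<close> by \<open>T m / e\<^sup>2\<close>. This
  tends to 0, so almost surely the partial sums are Cauchy.\<close>

lemma AE_coins_summable:
  fixes a :: "nat \<Rightarrow> real"
  assumes a: "summable (\<lambda>i. (a i)\<^sup>2)"
  shows "AE \<omega> in coins. summable (\<lambda>i. \<omega> i * a i)"
proof -
  \<comment> \<open>The first \<open>m\<close> coefficients are zeroed rather than shifted away: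
    tail sums then use the same coins at the same indices, and their differences are differences of
    the original partial sums.\<close>
  define b where "b m i = (if i < m then 0 else a i)" for m i
  define T where "T m = (\<Sum>i. (a i)\<^sup>2) - (\<Sum>i<m. (a i)\<^sup>2)" for m
  have T: "T \<longlonglongrightarrow> 0"
    using tendsto_diff[OF tendsto_const[of "\<Sum>i. (a i)\<^sup>2"] summable_LIMSEQ[OF a]] by (simp add: T_def[abs_def])
  have bT: "(\<Sum>i<n. (b m i)\<^sup>2) \<le> T m" for m n
  proof -
    have "(\<Sum>i<n. (b m i)\<^sup>2) = (\<Sum>i\<in>{m..<n}. (a i)\<^sup>2)"
      unfolding b_def by (rule sum.mono_neutral_cong_right) auto
    also have "\<dots> + (\<Sum>i<m. (a i)\<^sup>2) = (\<Sum>i\<in>{m..<n} \<union> {..<m}. (a i)\<^sup>2)"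
      by (subst sum.union_disjoint) auto
    also have "\<dots> \<le> (\<Sum>i. (a i)\<^sup>2)"
      by (rule sum_le_suminf[OF a]) auto
    finally show ?thesis
      by (simp add: T_def)
  qed
  have AE_e: "AE \<omega> in coins. \<exists>m. \<forall>k. \<bar>\<Sum>i<k. \<omega> i * b m i\<bar> < e" if e: "0 < e" for e
  proof (rule AE_I[where N="{\<omega>. \<forall>m. \<exists>k. e \<le> \<bar>\<Sum>i<k. \<omega> i * b m i\<bar>}"])
    show "{\<omega> \<in> space coins. \<not> (\<exists>m. \<forall>k. \<bar>\<Sum>i<k. \<omega> i * b m i\<bar> < e)} \<subseteq> {\<omega>. \<forall>m. \<exists>k. e \<le> \<bar>\<Sum>i<k. \<omega> i * b m i\<bar>}"
      by (auto simp: not_less)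
    have meas: "{\<omega> \<in> space coins. \<forall>m. \<exists>k. e \<le> \<bar>\<Sum>i<k. \<omega> i * b m i\<bar>} \<in> sets coins"
      by measurable
    then show "{\<omega>. \<forall>m. \<exists>k. e \<le> \<bar>\<Sum>i<k. \<omega> i * b m i\<bar>} \<in> sets coins"
      by simp
    have "emeasure coins {\<omega>. \<forall>m. \<exists>k. e \<le> \<bar>\<Sum>i<k. \<omega> i * b m i\<bar>} \<le> ennreal (T m / e\<^sup>2)" for m
    proof -
      let ?A = "\<lambda>n. {\<omega>. \<exists>k\<le>n. e \<le> \<bar>0 + (\<Sum>i<k. \<omega> i * b m i)\<bar>}"
      have [measurable]: "{\<omega> \<in> space coins. \<exists>k\<le>n. e \<le> \<bar>0 + (\<Sum>i<k. \<omega> i * b m i)\<bar>} \<in> sets coins" for n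
        by measurable
      then have A: "range ?A \<subseteq> sets coins" "incseq ?A"
        by (auto simp: incseq_def) (meson order_trans)
      have "emeasure coins {\<omega>. \<forall>m. \<exists>k. e \<le> \<bar>\<Sum>i<k. \<omega> i * b m i\<bar>} \<le> emeasure coins (\<Union>n. ?A n)"
      proof (rule emeasure_mono)
        show "{\<omega>. \<forall>m. \<exists>k. e \<le> \<bar>\<Sum>i<k. \<omega> i * b m i\<bar>} \<subseteq> (\<Union>n. ?A n)"
        proof
          fix \<omega> assume "\<omega> \<in> {\<omega>. \<forall>m. \<exists>k. e \<le> \<bar>\<Sum>i<k. \<omega> i * b m i\<bar>}"
          then obtain k where "e \<le> \<bar>\<Sum>i<k. \<omega> i * b m i\<bar>"
            by blast
          then have "\<omega> \<in> ?A k"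
            by auto
          then show "\<omega> \<in> (\<Union>n. ?A n)"
            by blast
        qed
        show "(\<Union>n. ?A n) \<in> sets coins"
          using A(1) by (rule sets.countable_UN)
      qed
      also have "\<dots> = (SUP n. emeasure coins (?A n))"
        using A by (rule SUP_emeasure_incseq[symmetric])
      also have "\<dots> \<le> ennreal (T m / e\<^sup>2)"
      proof (rule SUP_least)
        fix n
        show "emeasure coins (?A n) \<le> ennreal (T m / e\<^sup>2)"
          by (rule order_trans[OF coins_maximal_inequality[OF e]])
             (intro ennreal_leI divide_right_mono, auto simp: bT)
      qed
      finally show ?thesis .
    qed
    moreover have "(\<lambda>m. ennreal (T m / e\<^sup>2)) \<longlonglongrightarrow> ennreal (0 / e\<^sup>2)"
      using e by (intro tendsto_ennrealI tendsto_divide T tendsto_const) auto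
    ultimately have "emeasure coins {\<omega>. \<forall>m. \<exists>k. e \<le> \<bar>\<Sum>i<k. \<omega> i * b m i\<bar>} \<le> ennreal (0 / e\<^sup>2)"
      by (intro LIMSEQ_le_const) auto
    then show "emeasure coins {\<omega>. \<forall>m. \<exists>k. e \<le> \<bar>\<Sum>i<k. \<omega> i * b m i\<bar>} = 0"
      by simp
  qed
  have "AE \<omega> in coins. \<forall>j. \<exists>m. \<forall>k. \<bar>\<Sum>i<k. \<omega> i * b m i\<bar> < 1 / Suc j"
    unfolding AE_all_countable by (intro allI AE_e) auto
  then show ?thesis
  proof eventually_elim
    fix \<omega> :: "nat \<Rightarrow> real"
    assume *: "\<forall>j. \<exists>m. \<forall>k. \<bar>\<Sum>i<k. \<omega> i * b m i\<bar> < 1 / Suc j"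
    show "summable (\<lambda>i. \<omega> i * a i)"
      unfolding summable_Cauchy
    proof (intro allI impI)
      fix e :: real
      assume "0 < e"
      then obtain j where j: "1 / Suc j < e / 2"
        using nat_approx_posE[of "e / 2"] by (auto simp: inverse_eq_divide)
      from * obtain N where N: "\<And>k. \<bar>\<Sum>i<k. \<omega> i * b N i\<bar> < 1 / Suc j"
        by blast
      have "norm (\<Sum>i=m..<n. \<omega> i * a i) < e" if "N \<le> m" for m n
      proof (cases "m \<le> n")
        case True
        have "(\<Sum>i=m..<n. \<omega> i * a i) = (\<Sum>i=m..<n. \<omega> i * b N i)"
          using that by (intro sum.cong) (auto simp: b_def)
        also have "\<dots> = (\<Sum>i<n. \<omega> i * b N i) - (\<Sum>i<m. \<omega> i * b N i)"
          using sum_diff_nat_ivl[of 0 m n "\<lambda>i. \<omega> i * b N i"] True by (simp add: lessThan_atLeast0)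
        also have "\<bar>\<dots>\<bar> < e"
          using N[of n] N[of m] j by linarith
        finally show ?thesis
          by simp
      qed (use \<open>0 < e\<close> in simp)
      then show "\<exists>N. \<forall>m\<ge>N. \<forall>n. norm (\<Sum>i=m..<n. \<omega> i * a i) < e"
        by blast
    qed
  qed
qed

section \<open>Sign flips and the zero-one law\<close>

lemma distr_coins_flip:
  "distr coins coins (\<lambda>\<omega> i. if i = k then - \<omega> i else \<omega> i) = coins" (is "distr _ _ ?T = _")
proof (rule coin.PiM_eq)
  fix J :: "nat set" and F :: "nat \<Rightarrow> real set"
  assume J: "finite J" "J \<subseteq> UNIV" and F: "\<And>j. j \<in> J \<Longrightarrow> F j \<in> sets coin"
  \<comment> \<open>The flip pulls a cylinder back to the cylinder whose \<open>k\<close>-th side is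
    reflected, and \<open>coin\<close> gives a set and its reflection the same mass.\<close>
  define F' where "F' j = (if j = k then uminus -` F j else F j)" for j
  have F': "F' j \<in> sets coin" if "j \<in> J" for j
    using measurable_sets[of uminus borel borel "F j"] F[OF that] by (auto simp: F'_def)
  have T: "?T \<in> coins \<rightarrow>\<^sub>M coins"
    by (rule measurable_PiM_single') (auto simp: measurable_cong_sets[OF refl sets_coin])
  have emb: "prod_emb UNIV (\<lambda>_. coin) J (Pi\<^sub>E J G) = {\<omega>. \<forall>j\<in>J. \<omega> j \<in> G j}" for G
    by (auto simp: prod_emb_def PiE_iff)
  have "(?T \<omega> j \<in> F j) = (\<omega> j \<in> F' j)" for \<omega> j
    by (simp add: F'_def)
  then have "?T -` prod_emb UNIV (\<lambda>_. coin) J (Pi\<^sub>E J F) \<inter> space coins = prod_emb UNIV (\<lambda>_. coin) J (Pi\<^sub>E J F')"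
    unfolding emb by (simp add: vimage_def)
  then have "emeasure (distr coins coins ?T) (prod_emb UNIV (\<lambda>_. coin) J (Pi\<^sub>E J F)) =
      emeasure coins (prod_emb UNIV (\<lambda>_. coin) J (Pi\<^sub>E J F'))"
    using T J F by (subst emeasure_distr) (auto intro!: sets_PiM_I)
  also have "\<dots> = (\<Prod>j\<in>J. emeasure coin (F' j))"
    using J F' by (intro coin.emeasure_PiM_emb) auto
  also have "\<dots> = (\<Prod>j\<in>J. emeasure coin (F j))"
  proof (rule prod.cong)
    fix j assume j: "j \<in> J"
    show "emeasure coin (F' j) = emeasure coin (F j)"
      using F[OF j] F'[OF j] by (simp add: emeasure_coin) (auto simp: F'_def indicator_def add.commute)
  qed simp
  finally show "emeasure (distr coins coins ?T) (prod_emb UNIV (\<lambda>_. coin) J (Pi\<^sub>E J F)) = (\<Prod>j\<in>J. emeasure coin (F j))" .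
qed simp

text \<open>Being a tail event is expressed without tail sigma-algebras: for every \<open>m\<close>,
  the event must be a measurable condition on the sequence shifted by \<open>m\<close>. This is the
  form in which convergence statements are naturally checked.\<close>

lemma coins_0_1_law:
  assumes Q [measurable]: "\<And>m. Measurable.pred (\<Pi>\<^sub>M i\<in>UNIV. borel) (Q m)"
    and P: "\<And>m \<omega>. P \<omega> \<longleftrightarrow> Q m (\<lambda>i. \<omega> (i + m))"
  shows "measure coins {\<omega>. P \<omega>} = 0 \<or> measure coins {\<omega>. P \<omega>} = 1"
proof -
  let ?F = "\<lambda>i. {(\<lambda>\<omega>. \<omega> i) -` B \<inter> space coins | B. B \<in> sets (borel :: real measure)}"
  show ?thesis
  proof (rule coin.P.kolmogorov_0_1_law)
    show "sigma_algebra (space coins) (?F i)" for i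
      using sets_vimage_algebra2[of "\<lambda>\<omega>. \<omega> i" "space coins" "borel :: real measure"]
        sets.sigma_algebra_axioms[of "vimage_algebra (space coins) (\<lambda>\<omega>. \<omega> i) (borel :: real measure)"]
      by simp
    have "coin.P.indep_vars (\<lambda>_. borel) (\<lambda>i \<omega>. \<omega> i) UNIV"
    proof (subst coin.P.indep_vars_iff_distr_eq_PiM)
      have "distr coins borel (\<lambda>\<omega>. \<omega> i) = coin" for i
        using coin.PiM_component[of i] by (simp cong: distr_cong)
      then show "distr coins (\<Pi>\<^sub>M i\<in>UNIV. borel) (\<lambda>\<omega>. \<lambda>i\<in>UNIV. \<omega> i) = (\<Pi>\<^sub>M i\<in>UNIV. distr coins borel (\<lambda>\<omega>. \<omega> i))"
        using distr_id2[OF sets_coins[symmetric]] by (simp add: restrict_UNIV)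
    qed auto
    then show "coin.P.indep_sets ?F UNIV"
      by (simp add: coin.P.indep_vars_def2)
    show "{\<omega>. P \<omega>} \<in> coin.P.tail_events ?F"
      unfolding coin.P.tail_events_def
    proof (rule INT_I)
      fix m :: nat
      let ?S = "sigma UNIV (\<Union>(?F ` {m..}))"
      have "(\<lambda>\<omega> i. \<omega> (i + m)) \<in> ?S \<rightarrow>\<^sub>M (\<Pi>\<^sub>M i\<in>UNIV. borel)"
      proof (rule measurable_PiM_single')
        show "(\<lambda>\<omega>. \<omega> (i + m)) \<in> borel_measurable ?S" for i
        proof (rule measurableI)
          fix B :: "real set"
          assume "B \<in> sets borel"
          then have "(\<lambda>\<omega>. \<omega> (i + m)) -` B \<inter> space coins \<in> ?F (i + m)"
            by blast
          then have "(\<lambda>\<omega>. \<omega> (i + m)) -` B \<in> \<Union>(?F ` {m..})"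
            by (intro UN_I[of "i + m"]) auto
          then have "(\<lambda>\<omega>. \<omega> (i + m)) -` B \<in> sigma_sets UNIV (\<Union>(?F ` {m..}))"
            by (rule sigma_sets.Basic)
          then show "(\<lambda>\<omega>. \<omega> (i + m)) -` B \<inter> space ?S \<in> sets ?S"
            by simp
        qed simp
      qed auto
      from measurable_compose[OF this Q[of m]]
      moreover have "(\<lambda>\<omega>. Q m (\<lambda>i. \<omega> (i + m))) = P"
        using P[of _ m] by (intro ext) blast
      ultimately have "Measurable.pred ?S P"
        by (simp only:)
      then have "{\<omega> \<in> space ?S. P \<omega>} \<in> sets ?S"
        by (rule predE)
      then show "{\<omega>. P \<omega>} \<in> sigma_sets (space coins) (\<Union>(?F ` {m..}))"
        by simp
    qed
  qed
qed

section \<open>Measurability of convergence\<close>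

lemma pred_summable [measurable]:
  fixes f :: "nat \<Rightarrow> 'a \<Rightarrow> real"
  assumes [measurable]: "\<And>i. f i \<in> borel_measurable M"
  shows "Measurable.pred M (\<lambda>x. summable (\<lambda>i. f i x))"
proof -
  have "summable (\<lambda>i. f i x) \<longleftrightarrow> Cauchy (\<lambda>n. \<Sum>i<n. f i x)" for x
    by (simp add: summable_iff_convergent Cauchy_convergent_iff)
  then show ?thesis
    using sets_Collect_Cauchy[of "\<lambda>n x. \<Sum>i<n. f i x" M] by (simp add: pred_def)
qed

text \<open>With \<open>1 / real (Suc j)\<close> in place of an arbitrary positive real, every
  quantifier ranges over a countable set, so measurability follows from that of the individual
  terms.\<close>

lemma LIMSEQ_0_iff: "x \<longlonglongrightarrow> 0 \<longleftrightarrow> (\<forall>j. \<exists>N. \<forall>n\<ge>N. \<bar>x n\<bar> < 1 / real (Suc j))" for x :: "nat \<Rightarrow> real"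
proof
  assume "x \<longlonglongrightarrow> 0"
  then show "\<forall>j. \<exists>N. \<forall>n\<ge>N. \<bar>x n\<bar> < 1 / real (Suc j)"
    by (auto simp: LIMSEQ_def dist_real_def)
next
  assume *: "\<forall>j. \<exists>N. \<forall>n\<ge>N. \<bar>x n\<bar> < 1 / real (Suc j)"
  show "x \<longlonglongrightarrow> 0"
  proof (rule LIMSEQ_I)
    fix e :: real assume "0 < e"
    then obtain j where "1 / real (Suc j) < e"
      using nat_approx_posE by blast
    then show "\<exists>no. \<forall>n\<ge>no. norm (x n - 0) < e"
      using *[rule_format, of j] by (force intro: order_less_trans)
  qed
qed

lemma pred_LIMSEQ_0 [measurable]:
  fixes f :: "nat \<Rightarrow> 'a \<Rightarrow> real"
  assumes [measurable]: "\<And>i. f i \<in> borel_measurable M"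
  shows "Measurable.pred M (\<lambda>x. (\<lambda>i. f i x) \<longlonglongrightarrow> 0)"
  unfolding LIMSEQ_0_iff by measurable

lemma AE_coin_abs: "AE \<omega> in coins. \<bar>\<omega> k\<bar> = 1"
proof (rule coin.AE_component)
  show "AE x in coin. \<bar>x\<bar> = 1"
    unfolding coin_def by (subst AE_distr_iff) (auto simp: AE_measure_pmf_iff)
qed simp

text \<open>Flipping coin \<open>k\<close> moves the sum by
  \<open>2 * \<bar>a k\<bar> \<ge> 2\<close>, so the original and the flipped sum cannot both lie in
  the open interval from -1 to 1. The two events therefore cover almost everything, and they are
  equally likely.\<close>

lemma coins_anticoncentration:
  fixes a :: "nat \<Rightarrow> real"
  assumes a: "summable (\<lambda>i. (a i)\<^sup>2)" and k: "1 \<le> \<bar>a k\<bar>"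
  shows "1 / 2 \<le> measure coins {\<omega>. 1 \<le> \<bar>\<Sum>i. \<omega> i * a i\<bar>}"
proof -
  let ?T = "\<lambda>\<omega> i. if i = k then - \<omega> i else \<omega> i :: real"
  let ?B = "{\<omega>. 1 \<le> \<bar>\<Sum>i. \<omega> i * a i\<bar>}"
  have T: "?T \<in> coins \<rightarrow>\<^sub>M coins"
    by (rule measurable_PiM_single') (auto simp: measurable_cong_sets[OF refl sets_coin])
  have "{\<omega> \<in> space coins. 1 \<le> \<bar>\<Sum>i. \<omega> i * a i\<bar>} \<in> sets coins"
    by measurable
  then have B: "?B \<in> sets coins"
    by simp
  then have TB: "?T -` ?B \<in> sets coins"
    using measurable_sets[OF T B] by (simp only: space_coins Int_UNIV_right)
  have "AE \<omega> in coins. \<omega> \<in> ?B \<union> ?T -` ?B"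
    using AE_coins_summable[OF a] AE_coin_abs[of k]
  proof eventually_elim
    fix \<omega> :: "nat \<Rightarrow> real"
    assume s: "summable (\<lambda>i. \<omega> i * a i)" and wk: "\<bar>\<omega> k\<bar> = 1"
    \<comment> \<open>The flipped series is the original one plus a series with a single term, which
      settles both its convergence and its value.\<close>
    have "(\<lambda>i. \<omega> i * a i + (if i = k then - 2 * \<omega> k * a k else 0)) sums ((\<Sum>i. \<omega> i * a i) + (- 2 * \<omega> k * a k))"
      by (intro sums_add summable_sums s sums_single)
    moreover have "(\<lambda>i. \<omega> i * a i + (if i = k then - 2 * \<omega> k * a k else 0)) = (\<lambda>i. ?T \<omega> i * a i)"
      by (auto simp: fun_eq_iff algebra_simps)
    ultimately have "(\<lambda>i. ?T \<omega> i * a i) sums ((\<Sum>i. \<omega> i * a i) - 2 * \<omega> k * a k)"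
      by simp
    then have "(\<Sum>i. ?T \<omega> i * a i) = (\<Sum>i. \<omega> i * a i) - 2 * \<omega> k * a k"
      by (simp add: sums_iff)
    moreover have "1 \<le> \<bar>\<omega> k * a k\<bar>"
      using k wk by (simp add: abs_mult)
    ultimately show "\<omega> \<in> ?B \<union> ?T -` ?B"
      by simp linarith
  qed
  then have "1 \<le> measure coins (?B \<union> ?T -` ?B)"
    using B TB by (subst (asm) coin.P.prob_eq_1[symmetric]) auto
  also have "\<dots> \<le> measure coins ?B + measure coins (?T -` ?B)"
    using B TB by (rule measure_Un_le)
  also have "measure coins (?T -` ?B) = measure (distr coins coins ?T) ?B"
    using T B by (simp add: measure_distr)
  finally show ?thesis
    by (simp add: distr_coins_flip)
qed

text \<open>By \<open>null\<close>, finitely many columns contribute nothing in the limit, so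
  convergence of the row sums to 0 is a tail event and has probability 0 or 1. Probability 1 is
  excluded: it would send the probability that a row sum is at least 1 in modulus to 0, while
  \<open>big\<close> keeps it at one half or more for infinitely many rows.\<close>

lemma AE_coins_array_not_null:
  fixes x :: "nat \<Rightarrow> nat \<Rightarrow> real"
  assumes sq: "\<And>n. summable (\<lambda>k. (x n k)\<^sup>2)"
    and null: "\<And>k. (\<lambda>n. x n k) \<longlonglongrightarrow> 0"
    and big: "\<exists>\<^sub>\<infinity>n. \<exists>k. 1 \<le> \<bar>x n k\<bar>"
  shows "AE \<omega> in coins. \<not> (\<lambda>n. \<Sum>k. \<omega> k * x n k) \<longlonglongrightarrow> 0"
proof -
  \<comment> \<open>Summability of every row is part of the event because \<open>suminf\<close> is
    meaningless on a divergent series; with it, dropping the first \<open>m\<close> terms changes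
    each row sum by exactly a finite sum.\<close>
  define Q where "Q m \<omega> \<longleftrightarrow> (\<forall>n. summable (\<lambda>k. \<omega> k * x n (k + m))) \<and> (\<lambda>n. \<Sum>k. \<omega> k * x n (k + m)) \<longlonglongrightarrow> 0"
    for m and \<omega> :: "nat \<Rightarrow> real"
  have Q [measurable]: "Measurable.pred (\<Pi>\<^sub>M i\<in>UNIV. borel) (Q m)" for m
    unfolding Q_def by measurable
  have "Q 0 \<omega> \<longleftrightarrow> Q m (\<lambda>i. \<omega> (i + m))" for m \<omega>
  proof -
    have sm: "summable (\<lambda>k. \<omega> (k + m) * x n (k + m)) \<longleftrightarrow> summable (\<lambda>k. \<omega> k * x n k)" for n
      by (rule summable_iff_shift)
    have eq: "(\<Sum>k. \<omega> k * x n k) = (\<Sum>k. \<omega> (k + m) * x n (k + m)) + (\<Sum>k<m. \<omega> k * x n k)"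
      if "summable (\<lambda>k. \<omega> k * x n k)" for n
      using that by (rule suminf_split_initial_segment)
    have "(\<lambda>n. \<Sum>k<m. \<omega> k * x n k) \<longlonglongrightarrow> (\<Sum>k<m. \<omega> k * 0)"
      by (intro tendsto_intros null)
    then have fin: "(\<lambda>n. \<Sum>k<m. \<omega> k * x n k) \<longlonglongrightarrow> 0"
      by simp
    show ?thesis
      unfolding Q_def
      using tendsto_add[OF _ fin, of "\<lambda>n. \<Sum>k. \<omega> (k + m) * x n (k + m)" 0]
        tendsto_diff[OF _ fin, of "\<lambda>n. \<Sum>k. \<omega> k * x n k" 0]
      by (auto simp: sm eq)
  qed
  from coins_0_1_law[of Q, OF Q this] consider "measure coins {\<omega>. Q 0 \<omega>} = 0" | "measure coins {\<omega>. Q 0 \<omega>} = 1"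
    by blast
  then have "AE \<omega> in coins. \<not> Q 0 \<omega>"
  proof cases
    case 1
    have "{\<omega> \<in> space coins. Q 0 \<omega>} \<in> sets coins"
      by measurable
    with 1 show ?thesis
      by (subst (asm) coin.P.prob_eq_0) auto
  next
    case 2
    have "{\<omega> \<in> space coins. Q 0 \<omega>} \<in> sets coins"
      by measurable
    with 2 have Q0: "AE \<omega> in coins. Q 0 \<omega>"
      by (subst (asm) coin.P.prob_eq_1) auto
    let ?B = "\<lambda>n. {\<omega>. 1 \<le> \<bar>\<Sum>k. \<omega> k * x n k\<bar>}"
    have "{\<omega> \<in> space coins. 1 \<le> \<bar>\<Sum>k. \<omega> k * x n k\<bar>} \<in> sets coins" for n
      by measurable
    then have B: "?B n \<in> sets coins" for n
      by simp
    \<comment> \<open>Almost sure convergence to 0 makes the indicators of \<open>?B n\<close>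
      vanish eventually; dominated convergence turns this into convergence of the
      probabilities.\<close>
    have "(\<lambda>n. \<integral>\<omega>. indicator (?B n) \<omega> \<partial>coins) \<longlonglongrightarrow> (\<integral>\<omega>. (0::real) \<partial>coins)"
    proof (rule integral_dominated_convergence[where w="\<lambda>_. 1"])
      show "(\<lambda>\<omega>. indicator (?B n) \<omega> :: real) \<in> borel_measurable coins" for n
        using B by (rule borel_measurable_indicator)
      show "AE \<omega> in coins. (\<lambda>n. indicator (?B n) \<omega> :: real) \<longlonglongrightarrow> 0"
        using Q0
      proof eventually_elim
        fix \<omega> assume "Q 0 \<omega>"
        then have "(\<lambda>n. \<bar>\<Sum>k. \<omega> k * x n k\<bar>) \<longlonglongrightarrow> 0"
          unfolding Q_def by (auto intro: tendsto_rabs_zero)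
        then have "eventually (\<lambda>n. \<bar>\<Sum>k. \<omega> k * x n k\<bar> < 1) sequentially"
          by (rule order_tendstoD) simp
        then show "(\<lambda>n. indicator (?B n) \<omega> :: real) \<longlonglongrightarrow> 0"
          by (intro tendsto_eventually) (auto elim!: eventually_mono simp: indicator_def)
      qed
    qed (auto simp: indicator_def)
    then have "(\<lambda>n. measure coins (?B n)) \<longlonglongrightarrow> 0"
      using B by simp
    then have "eventually (\<lambda>n. measure coins (?B n) < 1 / 2) sequentially"
      by (rule order_tendstoD) simp
    moreover have "\<exists>\<^sub>F n in sequentially. 1 / 2 \<le> measure coins (?B n)"
      using big unfolding cofinite_eq_sequentially
      by (rule frequently_elim1) (use coins_anticoncentration sq in blast)
    ultimately have False
      by (metis (mono_tags, lifting) eventually_mono frequently_def linorder_not_le)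
    then show ?thesis ..
  qed
  moreover have "AE \<omega> in coins. \<forall>n. summable (\<lambda>k. \<omega> k * x n k)"
    unfolding AE_all_countable using AE_coins_summable[OF sq] by blast
  ultimately show ?thesis
    by eventually_elim (simp add: Q_def)
qed

section \<open>The stable constant\<close>

text \<open>The first bound serves at infinity. The second, from
  \<open>\<bar>sin x\<bar> \<le> \<bar>x\<bar>\<close>, gains one power at the origin; together they
  give integrability for \<open>1 < \<eta> < 2\<close>.\<close>

lemma abs_powr_mult_sin_le:
  fixes x :: real
  assumes x: "0 \<le> x"
  shows "\<bar>x powr (- \<eta>) * sin x\<bar> \<le> x powr (- \<eta>)" "\<bar>x powr (- \<eta>) * sin x\<bar> \<le> x powr (1 - \<eta>)"
proof -
  show "\<bar>x powr (- \<eta>) * sin x\<bar> \<le> x powr (- \<eta>)"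
    using mult_left_mono[OF abs_sin_le_one, of "x powr (- \<eta>)" x] by (simp add: abs_mult)
  have "\<bar>x powr (- \<eta>) * sin x\<bar> \<le> x powr (- \<eta>) * x"
    using mult_left_mono[OF abs_sin_x_le_abs_x, of "x powr (- \<eta>)" x] x by (simp add: abs_mult)
  also have "x powr (- \<eta>) * x = x powr (1 - \<eta>)"
    using x by (cases "x = 0") (auto simp: powr_diff powr_minus field_simps)
  finally show "\<bar>x powr (- \<eta>) * sin x\<bar> \<le> x powr (1 - \<eta>)" .
qed

text \<open>A common majorant for all exponents between \<open>a\<close> and \<open>b\<close>: near
  the origin the largest exponent is the worst, at infinity the smallest.\<close>

definition powr_sin_majorant :: "real \<Rightarrow> real \<Rightarrow> real \<Rightarrow> real" where
  "powr_sin_majorant a b x = (if x \<le> 1 then x powr (1 - b) else x powr (- a))"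

lemma powr_sin_majorant_integrable:
  assumes "1 < a" "b < 2"
  shows "powr_sin_majorant a b integrable_on {0..}"
proof -
  have "(\<lambda>x. x powr (1 - b)) integrable_on {0..1}"
    using has_integral_powr_from_0[of "1 - b" 1] assms by (auto simp: integrable_on_def)
  then have 1: "powr_sin_majorant a b integrable_on {0..1}"
    by (rule integrable_eq) (simp add: powr_sin_majorant_def)
  have "(\<lambda>x. x powr (- a)) integrable_on {1..}"
    using has_integral_powr_to_inf[of "- a" 1] assms by (auto simp: integrable_on_def)
  then have 2: "powr_sin_majorant a b integrable_on {1..}"
    by (rule integrable_eq) (auto simp: powr_sin_majorant_def)
  have "{0..1} \<union> {1..} = {0::real..}" "{0..1} \<inter> {1..} = {1::real}"
    by auto
  with integrable_Un'[OF 1 2] show ?thesis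
    by simp
qed

lemma powr_sin_absolutely_integrable:
  assumes "1 < \<eta>" "\<eta> < 2"
  shows "(\<lambda>x::real. x powr (- \<eta>) * sin x) absolutely_integrable_on {0..}"
proof (rule measurable_bounded_by_integrable_imp_absolutely_integrable)
  show "(\<lambda>x::real. x powr (- \<eta>) * sin x) \<in> borel_measurable (lebesgue_on {0..})"
    by (intro measurable_restrict_space1 measurable_completion) measurable
  show "powr_sin_majorant \<eta> \<eta> integrable_on {0..}"
    using assms by (rule powr_sin_majorant_integrable)
  show "norm (x powr (- \<eta>) * sin x) \<le> powr_sin_majorant \<eta> \<eta> x" if "x \<in> {0..}" for x
    using that abs_powr_mult_sin_le[of x \<eta>] by (simp add: powr_sin_majorant_def)
qed auto

text \<open>The inequality \<open>1 - exp (- y) \<le> y\<close> extracts the factor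
  \<open>(v - u) * \<bar>ln x\<bar>\<close>. The logarithm costs a power \<open>e\<close> of
  \<open>x\<close> (or of its inverse) divided by \<open>e\<close>, which is paid for by the margin
  \<open>e\<close> between the exponents \<open>u\<close>, \<open>v\<close> and the ends
  \<open>a\<close>, \<open>b\<close>.\<close>

lemma powr_diff_sin_le:
  fixes x :: real
  assumes x: "0 \<le> x" and e: "0 < e" and "a + e \<le> u" "u \<le> v" "v \<le> b - e"
  shows "\<bar>x powr (- u) * sin x - x powr (- v) * sin x\<bar> \<le> (v - u) / e * powr_sin_majorant a b x"
proof (cases "x = 0")
  case False
  then have x: "0 < x"
    using x by simp
  have eq: "x powr (- u) * sin x - x powr (- v) * sin x = (x powr (- u) - x powr (- v)) * sin x"
    by (simp add: algebra_simps)
  show ?thesis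
  proof (cases "x \<le> 1")
    case True
    have "x powr (- v) - x powr (- u) = x powr (- v) * (1 - exp (- ((v - u) * - ln x)))"
      using x by (simp add: powr_def right_diff_distrib exp_add[symmetric] algebra_simps)
    also have "\<dots> \<le> x powr (- v) * ((v - u) * - ln x)"
      using exp_ge_add_one_self[of "- ((v - u) * - ln x)"] by (intro mult_left_mono) (auto simp del: exp_ge_add_one_self)
    also have "- ln x \<le> x powr (- e) / e"
      using ln_powr_bound[of "inverse x" e] x True e by (simp add: ln_inverse powr_minus inverse_powr one_le_inverse)
    finally have 1: "x powr (- v) - x powr (- u) \<le> x powr (- v) * ((v - u) * (x powr (- e) / e))"
      using assms by (simp add: mult_left_mono)
    have 2: "0 \<le> x powr (- v) - x powr (- u)"
      using x True assms by (simp add: powr_mono')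
    have "\<bar>(x powr (- u) - x powr (- v)) * sin x\<bar> \<le> (x powr (- v) * ((v - u) * (x powr (- e) / e))) * x"
      using 1 2 x abs_sin_x_le_abs_x[of x] unfolding abs_mult by (intro mult_mono) auto
    also have "\<dots> = (v - u) / e * x powr (1 - v - e)"
      using x by (simp add: powr_diff powr_minus powr_add field_simps)
    also have "x powr (1 - v - e) \<le> x powr (1 - b)"
      using x True assms by (intro powr_mono') auto
    finally show ?thesis
      using True assms by (simp add: eq powr_sin_majorant_def mult_left_mono divide_right_mono)
  next
    case False
    have "x powr (- u) - x powr (- v) = x powr (- u) * (1 - exp (- ((v - u) * ln x)))"
      using x by (simp add: powr_def right_diff_distrib exp_add[symmetric] algebra_simps)
    also have "\<dots> \<le> x powr (- u) * ((v - u) * ln x)"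
      using exp_ge_add_one_self[of "- ((v - u) * ln x)"] by (intro mult_left_mono) (auto simp del: exp_ge_add_one_self)
    also have "ln x \<le> x powr e / e"
      using ln_powr_bound[of x e] False e by simp
    finally have 1: "x powr (- u) - x powr (- v) \<le> x powr (- u) * ((v - u) * (x powr e / e))"
      using assms by (simp add: mult_left_mono)
    have 2: "0 \<le> x powr (- u) - x powr (- v)"
      using False assms by simp
    have "\<bar>(x powr (- u) - x powr (- v)) * sin x\<bar> \<le> (x powr (- u) * ((v - u) * (x powr e / e))) * 1"
      using 1 2 abs_sin_le_one[of x] unfolding abs_mult by (intro mult_mono) auto
    also have "\<dots> = (v - u) / e * x powr (- u + e)"
      using x by (simp add: powr_diff powr_minus field_simps)
    also have "x powr (- u + e) \<le> x powr (- a)"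
      using False assms by (intro powr_mono) auto
    finally show ?thesis
      using False assms by (simp add: eq powr_sin_majorant_def mult_left_mono divide_right_mono)
  qed
qed (use assms in \<open>simp add: powr_sin_majorant_def\<close>)

text \<open>
  Integration by parts turns the integral into \<open>\<eta>\<close> times that of \<open>(1 - cos x) * x powr (- \<eta> - 1)\<close>,
  which is non-negative.
\<close>

lemma powr_sin_integral_pos:
  assumes \<eta>: "1 < \<eta>" "\<eta> < 2"
  shows "0 < integral {0..} (\<lambda>x::real. x powr (- \<eta>) * sin x)"
proof -
  let ?f = "\<lambda>x::real. x powr (- \<eta>) * sin x"
  let ?F = "\<lambda>x::real. (1 - cos x) * x powr (- \<eta>)"
  let ?g = "\<lambda>x::real. (1 - cos x) * x powr (- \<eta> - 1)"
  \<comment> \<open>On this interval the integrand is at least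
    \<open>(1 - cos 1) * 2 powr (- \<eta> - 1)\<close>, because cosine decreases on the interval
    from 0 to \<open>pi\<close>, which contains 2.\<close>
  define c where "c = integral {1..2} ?g"
  have fN: "?f integrable_on {0..real N}" "?f integrable_on {real N..}" for N
    by (rule set_lebesgue_integral_eq_integral(1), rule set_integrable_subset[OF powr_sin_absolutely_integrable[OF \<eta>]], auto)+
  have F_le: "0 \<le> ?F x \<and> ?F x \<le> x powr (2 - \<eta>)" if "0 \<le> x" for x
  proof -
    have "1 - cos x = 2 * (sin (x / 2))\<^sup>2"
      using cos_double_sin[of "x / 2"] by simp
    also have "(sin (x / 2))\<^sup>2 \<le> (x / 2)\<^sup>2"
      using abs_sin_x_le_abs_x[of "x / 2"] by (rule abs_le_square_iff[THEN iffD1])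
    finally have "1 - cos x \<le> x\<^sup>2 / 2"
      by (simp add: power_divide)
    also have "\<dots> \<le> x\<^sup>2"
      by simp
    finally have "1 - cos x \<le> x\<^sup>2" .
    then have "?F x \<le> x\<^sup>2 * x powr (- \<eta>)"
      by (rule mult_right_mono) simp
    also have "\<dots> = x powr (2 - \<eta>)"
      using that by (cases "x = 0") (auto simp: powr_diff powr_minus field_simps)
    finally show ?thesis
      by simp
  qed
  \<comment> \<open>At the origin \<open>x powr (- \<eta>)\<close> is unbounded; the factor
    \<open>1 - cos x \<le> x\<^sup>2\<close> leaves \<open>x powr (2 - \<eta>)\<close>, which tends
    to 0 because \<open>\<eta> < 2\<close>.\<close>
  have contF: "continuous_on {0..real N} ?F" for N
    unfolding continuous_on_eq_continuous_within
  proof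
    fix x assume x: "x \<in> {0..real N}"
    show "continuous (at x within {0..real N}) ?F"
    proof (cases "x = 0")
      case True
      have lim: "((\<lambda>x. x powr (2 - \<eta>)) \<longlongrightarrow> 0) (at 0 within {0..real N})"
        using \<eta> by (intro tendsto_zero_powrI[where b = "2 - \<eta>"]) (auto simp: eventually_at_filter)
      have ev: "\<forall>\<^sub>F x in at 0 within {0..real N}. 0 \<le> ?F x"
          "\<forall>\<^sub>F x in at 0 within {0..real N}. ?F x \<le> x powr (2 - \<eta>)"
        unfolding eventually_at_filter by (rule always_eventually, use F_le in simp)+
      have "(?F \<longlongrightarrow> 0) (at 0 within {0..real N})"
        by (rule tendsto_sandwich[OF ev tendsto_const lim])
      then show ?thesis
        by (simp add: True continuous_within)
    next
      case False
      with x show ?thesis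
        by (intro continuous_intros) auto
    qed
  qed
  have step: "((\<lambda>x. ?f x - \<eta> * ?g x) has_integral (?F (real N) - ?F 0)) {0..real N}" for N
  proof (rule fundamental_theorem_of_calculus_interior)
    show "(?F has_vector_derivative (?f x - \<eta> * ?g x)) (at x)" if "x \<in> {0<..<real N}" for x
      unfolding has_real_derivative_iff_has_vector_derivative[symmetric]
      using that by (auto intro!: derivative_eq_intros simp: algebra_simps)
  qed (use contF in auto)
  have g: "?g integrable_on {0..real N}" for N
  proof -
    have "(\<lambda>x. ?f x - (?f x - \<eta> * ?g x)) integrable_on {0..real N}"
      by (rule integrable_diff[OF fN(1) has_integral_integrable[OF step]])
    then have "(\<lambda>x. (?f x - (?f x - \<eta> * ?g x)) / \<eta>) integrable_on {0..real N}"
      by (rule integrable_on_divide)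
    then show ?thesis
      using \<eta> by simp
  qed
  have int: "?g integrable_on {1..2}"
    using g[of 2] by (rule integrable_on_subinterval) auto
  have "0 < c"
  proof -
    have "integral {1..2} (\<lambda>x::real. (1 - cos 1) * 2 powr (- \<eta> - 1)) \<le> c"
      unfolding c_def
    proof (rule integral_le)
      fix x :: real assume x: "x \<in> {1..2}"
      then have "cos x \<le> cos 1"
        using pi_gt3 by (intro cos_monotone_0_pi_le) auto
      moreover have "(2::real) powr (- \<eta> - 1) \<le> x powr (- \<eta> - 1)"
        using x \<eta> by (intro powr_mono2') auto
      ultimately show "(1 - cos 1) * 2 powr (- \<eta> - 1) \<le> ?g x"
        by (intro mult_mono) auto
    qed (use int in auto)
    then have "(1 - cos 1) * 2 powr (- \<eta> - 1) \<le> c"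
      by simp
    moreover have "cos (1::real) < cos 0"
      using pi_gt3 by (intro cos_monotone_0_pi) auto
    then have "0 < (1 - cos (1::real)) * 2 powr (- \<eta> - 1)"
      by simp
    ultimately show ?thesis
      by linarith
  qed
  \<comment> \<open>The boundary term \<open>?F (real N)\<close> is non-negative and is dropped; the
    part of the integral beyond \<open>N\<close> is bounded by the integral of
    \<open>x powr (- \<eta>)\<close>, which vanishes as \<open>N\<close> grows.\<close>
  have lower: "\<eta> * c - real N powr (1 - \<eta>) / (\<eta> - 1) \<le> integral {0..} ?f" if N: "2 \<le> N" for N
  proof -
    have "{0..real N} \<union> {real N..} = {0..}" "{0..real N} \<inter> {real N..} = {real N}"
      by auto
    with integral_Un[OF fN[of N]] have split: "integral {0..} ?f = integral {0..real N} ?f + integral {real N..} ?f"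
      by simp
    have hi: "((\<lambda>x. x powr (- \<eta>)) has_integral - (real N powr (- \<eta> + 1)) / (- \<eta> + 1)) {real N..}"
      using has_integral_powr_to_inf[of "- \<eta>" "real N"] N \<eta> by simp
    have "norm (integral {real N..} ?f) \<le> integral {real N..} (\<lambda>x. x powr (- \<eta>))"
      using hi fN abs_powr_mult_sin_le(1) by (intro integral_norm_bound_integral) (auto simp: integrable_on_def)
    also have "\<dots> = - (real N powr (- \<eta> + 1)) / (- \<eta> + 1)"
      using hi by (rule integral_unique)
    also have "\<dots> = real N powr (1 - \<eta>) / (\<eta> - 1)"
      using \<eta> by (simp add: field_simps)
    finally have tail: "\<bar>integral {real N..} ?f\<bar> \<le> real N powr (1 - \<eta>) / (\<eta> - 1)"
      by simp
    have "integral {0..real N} ?f - \<eta> * integral {0..real N} ?g = integral {0..real N} (\<lambda>x. ?f x - \<eta> * ?g x)"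
      using integral_diff[OF fN(1) integrable_on_cmult_left[OF g]] by simp
    also have "\<dots> = ?F (real N)"
      using step[of N] by (simp add: integral_unique)
    finally have "integral {0..real N} ?f \<ge> \<eta> * integral {0..real N} ?g"
      using F_le[of "real N", OF of_nat_0_le_iff] by linarith
    moreover have "c \<le> integral {0..real N} ?g"
      unfolding c_def using N by (intro integral_subset_le int g) auto
    then have "\<eta> * c \<le> \<eta> * integral {0..real N} ?g"
      using \<eta> by simp
    ultimately show ?thesis
      using split tail by linarith
  qed
  have "(\<lambda>N. \<eta> * c - real N powr (1 - \<eta>) / (\<eta> - 1)) \<longlonglongrightarrow> \<eta> * c - 0 / (\<eta> - 1)"
    using \<eta> by (intro tendsto_intros tendsto_neg_powr filterlim_real_sequentially) auto
  then have "\<eta> * c \<le> integral {0..} ?f"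
    using lower by (intro LIMSEQ_le_const2[of _ "\<eta> * c"]) auto
  moreover have "0 < \<eta> * c"
    using \<eta> \<open>0 < c\<close> by simp
  ultimately show ?thesis
    by linarith
qed

section \<open>Pointwise Lipschitz functions\<close>

text \<open>Regularity at the single point \<open>t\<close>, with a constant that may depend on
  \<open>t\<close>. Differentiability of \<open>stable_const\<close> would require differentiating
  under the integral, whereas a Lipschitz bound at a point is easier to obtain, is stable under
  products and composition, and suffices for comparing increments with powers below 1.\<close>

definition lip_at :: "(real \<Rightarrow> real) \<Rightarrow> real \<Rightarrow> bool" where
  "lip_at f t \<longleftrightarrow> (\<exists>C\<ge>0. \<forall>\<^sub>F s in nhds t. \<bar>f s - f t\<bar> \<le> C * \<bar>s - t\<bar>)"

lemma lip_atE:
  assumes "lip_at f t"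
  obtains C where "0 \<le> C" "\<forall>\<^sub>F s in nhds t. \<bar>f s - f t\<bar> \<le> C * \<bar>s - t\<bar>"
  using assms unfolding lip_at_def by blast

lemma lip_at_DERIV:
  assumes "(f has_real_derivative D) (at t)"
  shows "lip_at f t"
proof -
  have "((\<lambda>s. (f s - f t) / (s - t)) \<longlongrightarrow> D) (at t)"
    using assms by (simp add: has_field_derivative_iff)
  then have "((\<lambda>s. \<bar>(f s - f t) / (s - t)\<bar>) \<longlongrightarrow> \<bar>D\<bar>) (at t)"
    by (rule tendsto_rabs)
  then have "\<forall>\<^sub>F s in at t. \<bar>(f s - f t) / (s - t)\<bar> < \<bar>D\<bar> + 1"
    by (rule order_tendstoD) simp
  then have "\<forall>\<^sub>F s in nhds t. \<bar>f s - f t\<bar> \<le> (\<bar>D\<bar> + 1) * \<bar>s - t\<bar>"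
    unfolding eventually_at_filter
  proof eventually_elim
    fix s
    assume "s \<noteq> t \<longrightarrow> s \<in> UNIV \<longrightarrow> \<bar>(f s - f t) / (s - t)\<bar> < \<bar>D\<bar> + 1"
    then show "\<bar>f s - f t\<bar> \<le> (\<bar>D\<bar> + 1) * \<bar>s - t\<bar>"
      by (cases "s = t") (auto simp: abs_divide divide_less_eq)
  qed
  then show ?thesis
    unfolding lip_at_def by (intro exI[of _ "\<bar>D\<bar> + 1"]) auto
qed

lemma lip_at_isCont:
  assumes "lip_at f t"
  shows "isCont f t"
proof -
  obtain C where C: "\<forall>\<^sub>F s in nhds t. \<bar>f s - f t\<bar> \<le> C * \<bar>s - t\<bar>"
    using assms by (rule lip_atE)
  have lim: "((\<lambda>s. C * \<bar>s - t\<bar>) \<longlongrightarrow> 0) (at t)"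
    by (auto intro!: tendsto_eq_intros)
  have "\<forall>\<^sub>F s in at t. norm (f s - f t) \<le> C * \<bar>s - t\<bar>"
    unfolding eventually_at_filter using C by (rule eventually_mono) simp
  then have "((\<lambda>s. f s - f t) \<longlongrightarrow> 0) (at t)"
    using lim by (rule Lim_null_comparison)
  then show ?thesis
    by (simp add: isCont_def LIM_zero_iff)
qed

lemma lip_at_filterlim:
  assumes "lip_at f t"
  shows "filterlim f (nhds (f t)) (nhds t)"
  using lip_at_isCont[OF assms] by (simp add: isCont_def tendsto_at_iff_tendsto_nhds)

lemma lip_at_compose:
  assumes f: "lip_at f t" and g: "lip_at g (f t)"
  shows "lip_at (\<lambda>s. g (f s)) t"
proof -
  obtain C where C: "0 \<le> C" "\<forall>\<^sub>F s in nhds t. \<bar>f s - f t\<bar> \<le> C * \<bar>s - t\<bar>"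
    using f by (rule lip_atE)
  obtain D where D: "0 \<le> D" "\<forall>\<^sub>F y in nhds (f t). \<bar>g y - g (f t)\<bar> \<le> D * \<bar>y - f t\<bar>"
    using g by (rule lip_atE)
  have "\<forall>\<^sub>F s in nhds t. \<bar>g (f s) - g (f t)\<bar> \<le> (D * C) * \<bar>s - t\<bar>"
    using C(2) eventually_compose_filterlim[OF D(2) lip_at_filterlim[OF f]]
  proof eventually_elim
    fix s
    assume 1: "\<bar>f s - f t\<bar> \<le> C * \<bar>s - t\<bar>" and 2: "\<bar>g (f s) - g (f t)\<bar> \<le> D * \<bar>f s - f t\<bar>"
    show "\<bar>g (f s) - g (f t)\<bar> \<le> (D * C) * \<bar>s - t\<bar>"
      using order_trans[OF 2 mult_left_mono[OF 1 D(1)]] by (simp add: mult.assoc)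
  qed
  then show ?thesis
    using C(1) D(1) unfolding lip_at_def by (intro exI[of _ "D * C"]) auto
qed

lemma lip_at_add:
  assumes "lip_at f t" "lip_at g t"
  shows "lip_at (\<lambda>s. f s + g s) t"
proof -
  obtain C where C: "0 \<le> C" "\<forall>\<^sub>F s in nhds t. \<bar>f s - f t\<bar> \<le> C * \<bar>s - t\<bar>"
    using assms(1) by (rule lip_atE)
  obtain D where D: "0 \<le> D" "\<forall>\<^sub>F s in nhds t. \<bar>g s - g t\<bar> \<le> D * \<bar>s - t\<bar>"
    using assms(2) by (rule lip_atE)
  have "\<forall>\<^sub>F s in nhds t. \<bar>(f s + g s) - (f t + g t)\<bar> \<le> (C + D) * \<bar>s - t\<bar>"
    using C(2) D(2) by eventually_elim (simp add: distrib_right)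
  then show ?thesis
    using C(1) D(1) unfolding lip_at_def by (intro exI[of _ "C + D"]) auto
qed

lemma lip_at_mult:
  assumes f: "lip_at f t" and g: "lip_at g t"
  shows "lip_at (\<lambda>s. f s * g s) t"
proof -
  obtain C where C: "0 \<le> C" "\<forall>\<^sub>F s in nhds t. \<bar>f s - f t\<bar> \<le> C * \<bar>s - t\<bar>"
    using f by (rule lip_atE)
  obtain D where D: "0 \<le> D" "\<forall>\<^sub>F s in nhds t. \<bar>g s - g t\<bar> \<le> D * \<bar>s - t\<bar>"
    using g by (rule lip_atE)
  have bnd: "\<forall>\<^sub>F s in nhds t. \<bar>g s\<bar> < \<bar>g t\<bar> + 1"
    by (rule order_tendstoD[OF tendsto_rabs[OF lip_at_filterlim[OF g]]]) simp
  let ?E = "C * (\<bar>g t\<bar> + 1) + \<bar>f t\<bar> * D"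
  have "\<forall>\<^sub>F s in nhds t. \<bar>f s * g s - f t * g t\<bar> \<le> ?E * \<bar>s - t\<bar>"
    using C(2) D(2) bnd
  proof eventually_elim
    fix s
    assume 1: "\<bar>f s - f t\<bar> \<le> C * \<bar>s - t\<bar>" and 2: "\<bar>g s - g t\<bar> \<le> D * \<bar>s - t\<bar>" and 3: "\<bar>g s\<bar> < \<bar>g t\<bar> + 1"
    have "f s * g s - f t * g t = (f s - f t) * g s + f t * (g s - g t)"
      by (simp add: algebra_simps)
    also have "\<bar>\<dots>\<bar> \<le> \<bar>f s - f t\<bar> * \<bar>g s\<bar> + \<bar>f t\<bar> * \<bar>g s - g t\<bar>"
      by (metis abs_mult abs_triangle_ineq)
    also have "\<dots> \<le> (C * \<bar>s - t\<bar>) * (\<bar>g t\<bar> + 1) + \<bar>f t\<bar> * (D * \<bar>s - t\<bar>)"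
      using 1 2 3 C(1) by (intro add_mono mult_mono) auto
    finally show "\<bar>f s * g s - f t * g t\<bar> \<le> ?E * \<bar>s - t\<bar>"
      by (simp add: algebra_simps)
  qed
  then show ?thesis
    using C(1) D(1) unfolding lip_at_def by (intro exI[of _ ?E]) auto
qed

lemma lip_at_const [simp]: "lip_at (\<lambda>_. c) t"
  by (rule lip_at_DERIV[of _ 0]) simp

lemma lip_at_minus: "lip_at f t \<Longrightarrow> lip_at (\<lambda>s. - f s) t"
  using lip_at_mult[OF lip_at_const[of "- 1"]] by simp

lemma lip_at_diff: "lip_at f t \<Longrightarrow> lip_at g t \<Longrightarrow> lip_at (\<lambda>s. f s - g s) t"
  using lip_at_add[OF _ lip_at_minus] by simp

lemma lip_at_exp: "lip_at f t \<Longrightarrow> lip_at (\<lambda>s. exp (f s)) t"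
  by (rule lip_at_compose, assumption, rule lip_at_DERIV, rule DERIV_exp)

lemma lip_at_ln: "lip_at f t \<Longrightarrow> 0 < f t \<Longrightarrow> lip_at (\<lambda>s. ln (f s)) t"
  by (rule lip_at_compose, assumption, rule lip_at_DERIV, rule DERIV_ln)

lemma lip_at_inverse: "lip_at f t \<Longrightarrow> f t \<noteq> 0 \<Longrightarrow> lip_at (\<lambda>s. inverse (f s)) t"
  by (rule lip_at_compose, assumption, rule lip_at_DERIV, rule DERIV_inverse)

lemma lip_at_cong:
  assumes f: "lip_at f t" and eq: "\<forall>\<^sub>F s in nhds t. f s = g s"
  shows "lip_at g t"
proof -
  obtain C where C: "0 \<le> C" "\<forall>\<^sub>F s in nhds t. \<bar>f s - f t\<bar> \<le> C * \<bar>s - t\<bar>"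
    using f by (rule lip_atE)
  have "f t = g t"
    using eq by (rule eventually_nhds_x_imp_x)
  have "\<forall>\<^sub>F s in nhds t. \<bar>g s - g t\<bar> \<le> C * \<bar>s - t\<bar>"
    using C(2) eq by eventually_elim (simp add: \<open>f t = g t\<close>)
  then show ?thesis
    using C(1) unfolding lip_at_def by blast
qed

lemma lip_at_powr:
  assumes f: "lip_at f t" and g: "lip_at g t" and pos: "0 < f t"
  shows "lip_at (\<lambda>s. f s powr g s) t"
proof -
  have "\<forall>\<^sub>F s in nhds t. 0 < f s"
    using order_tendstoD(1)[OF lip_at_filterlim[OF f] pos] .
  then have "\<forall>\<^sub>F s in nhds t. f s powr g s = exp (g s * ln (f s))"
    by eventually_elim (simp add: powr_def)
  then have "\<forall>\<^sub>F s in nhds t. exp (g s * ln (f s)) = f s powr g s"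
    by eventually_elim simp
  with lip_at_exp[OF lip_at_mult[OF g lip_at_ln[OF f pos]]] show ?thesis
    by (rule lip_at_cong)
qed

text \<open>Makes each single coefficient of the series negligible at the scale
  \<open>\<bar>s - t\<bar> powr g\<close>.\<close>

lemma lip_at_little_o:
  assumes "lip_at f t" "g < 1"
  shows "((\<lambda>s. (f s - f t) / \<bar>s - t\<bar> powr g) \<longlongrightarrow> 0) (at t)"
proof -
  obtain C where C: "0 \<le> C" "\<forall>\<^sub>F s in nhds t. \<bar>f s - f t\<bar> \<le> C * \<bar>s - t\<bar>"
    using assms(1) by (rule lip_atE)
  have "((\<lambda>s. \<bar>s - t\<bar>) \<longlongrightarrow> 0) (at t)"
    by (auto intro!: tendsto_eq_intros)
  then have "((\<lambda>s. \<bar>s - t\<bar> powr (1 - g)) \<longlongrightarrow> 0) (at t)"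
    using assms(2) by (intro tendsto_zero_powrI[where b = "1 - g"]) auto
  then have lim: "((\<lambda>s. C * \<bar>s - t\<bar> powr (1 - g)) \<longlongrightarrow> 0) (at t)"
    by (rule tendsto_mult_right_zero)
  show ?thesis
  proof (rule Lim_null_comparison[OF _ lim])
    show "\<forall>\<^sub>F s in at t. norm ((f s - f t) / \<bar>s - t\<bar> powr g) \<le> C * \<bar>s - t\<bar> powr (1 - g)"
      unfolding eventually_at_filter using C(2)
    proof eventually_elim
      fix s
      assume 1: "\<bar>f s - f t\<bar> \<le> C * \<bar>s - t\<bar>"
      show "s \<noteq> t \<longrightarrow> s \<in> UNIV \<longrightarrow> norm ((f s - f t) / \<bar>s - t\<bar> powr g) \<le> C * \<bar>s - t\<bar> powr (1 - g)"
      proof (intro impI)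
        assume "s \<noteq> t"
        then have "C * \<bar>s - t\<bar> powr (1 - g) = (C * \<bar>s - t\<bar>) / \<bar>s - t\<bar> powr g"
          by (simp add: powr_diff)
        then show "norm ((f s - f t) / \<bar>s - t\<bar> powr g) \<le> C * \<bar>s - t\<bar> powr (1 - g)"
          using 1 by (simp add: divide_right_mono)
      qed
    qed
  qed
qed

section \<open>Dependence of the stable constant on the exponent\<close>

lemma lip_at_powr_sin_integral:
  assumes \<eta>: "1 < \<eta>" "\<eta> < 2"
  shows "lip_at (\<lambda>\<eta>. integral {0..} (\<lambda>x. x powr (- \<eta>) * sin x)) \<eta>"
proof -
  let ?f = "\<lambda>\<eta> x. x powr (- \<eta>) * sin x"
  \<comment> \<open>A quarter of the distance to the nearer end of the interval from 1 to 2: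
    exponents within \<open>e\<close> of \<open>\<eta>\<close>, enlarged by the margin
    \<open>e\<close> that the logarithm requires, stay strictly inside it.\<close>
  define e where "e = min (\<eta> - 1) (2 - \<eta>) / 4"
  define L where "L = integral {0..} (powr_sin_majorant (\<eta> - 2 * e) (\<eta> + 2 * e)) / e"
  have e: "0 < e" "1 < \<eta> - 2 * e" "\<eta> + 2 * e < 2"
    using \<eta> by (auto simp: e_def min_def field_simps)
  note sd = powr_sin_majorant_integrable[OF e(2,3)]
  have int: "?f u integrable_on {0..}" if "\<bar>u - \<eta>\<bar> \<le> e" for u
    using that e by (intro set_lebesgue_integral_eq_integral(1) powr_sin_absolutely_integrable) auto
  have diff: "\<bar>integral {0..} (?f u) - integral {0..} (?f v)\<bar> \<le> (v - u) * L"
    if "u \<le> v" "\<bar>u - \<eta>\<bar> \<le> e" "\<bar>v - \<eta>\<bar> \<le> e" for u v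
  proof -
    have "norm (integral {0..} (\<lambda>x. ?f u x - ?f v x)) \<le> integral {0..} (\<lambda>x. (v - u) / e * powr_sin_majorant (\<eta> - 2 * e) (\<eta> + 2 * e) x)"
    proof (rule integral_norm_bound_integral)
      show "norm (?f u x - ?f v x) \<le> (v - u) / e * powr_sin_majorant (\<eta> - 2 * e) (\<eta> + 2 * e) x" if "x \<in> {0..}" for x
        using powr_diff_sin_le[of x e "\<eta> - 2 * e" u v "\<eta> + 2 * e"] that e \<open>u \<le> v\<close> \<open>\<bar>u - \<eta>\<bar> \<le> e\<close> \<open>\<bar>v - \<eta>\<bar> \<le> e\<close>
        by (simp add: abs_le_iff)
      show "(\<lambda>x. ?f u x - ?f v x) integrable_on {0..}"
        using int that by (intro integrable_diff) auto
      show "(\<lambda>x. (v - u) / e * powr_sin_majorant (\<eta> - 2 * e) (\<eta> + 2 * e) x) integrable_on {0..}"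
        using sd by (rule integrable_on_mult_right)
    qed
    also have "integral {0..} (\<lambda>x. ?f u x - ?f v x) = integral {0..} (?f u) - integral {0..} (?f v)"
      using int that by (intro integral_diff) auto
    finally show ?thesis
      by (simp add: L_def)
  qed
  have "0 \<le> integral {0..} (powr_sin_majorant (\<eta> - 2 * e) (\<eta> + 2 * e))"
    using sd by (rule integral_nonneg) (simp add: powr_sin_majorant_def)
  then have "0 \<le> L"
    using e by (simp add: L_def)
  moreover have "\<forall>\<^sub>F u in nhds \<eta>. \<bar>u - \<eta>\<bar> < e"
    using e(1) by (auto simp: eventually_nhds_metric dist_real_def)
  then have "\<forall>\<^sub>F u in nhds \<eta>. \<bar>integral {0..} (?f u) - integral {0..} (?f \<eta>)\<bar> \<le> L * \<bar>u - \<eta>\<bar>"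
  proof eventually_elim
    fix u assume u: "\<bar>u - \<eta>\<bar> < e"
    show "\<bar>integral {0..} (?f u) - integral {0..} (?f \<eta>)\<bar> \<le> L * \<bar>u - \<eta>\<bar>"
      using diff[of u \<eta>] diff[of \<eta> u] u e(1) by (cases "u \<le> \<eta>") (auto simp: abs_minus_commute mult.commute)
  qed
  ultimately show ?thesis
    unfolding lip_at_def by blast
qed

lemma stable_const_pos: "1 < \<eta> \<Longrightarrow> \<eta> < 2 \<Longrightarrow> 0 < stable_const \<eta>"
  using powr_sin_integral_pos by (simp add: stable_const_def)

lemma lip_at_stable_const:
  assumes "1 < \<eta>" "\<eta> < 2"
  shows "lip_at stable_const \<eta>"
proof -
  have "lip_at (\<lambda>\<eta>. inverse (integral {0..} (\<lambda>x. x powr (- \<eta>) * sin x))) \<eta>"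
    using powr_sin_integral_pos[OF assms] by (intro lip_at_inverse lip_at_powr_sin_integral assms) simp
  then show ?thesis
    by (simp add: stable_const_def[abs_def])
qed

section \<open>Arrival times\<close>

text \<open>The probability generating function of the Poisson law; its values at
  \<open>s = 2\<close> and \<open>s = 1 / 2\<close> give the two Chernoff bounds below.\<close>

lemma nn_integral_power_poisson_pmf:
  assumes "0 < r" "0 \<le> s"
  shows "(\<integral>\<^sup>+k. ennreal (s ^ k) \<partial>measure_pmf (poisson_pmf r)) = ennreal (exp (r * s - r))"
proof -
  have sums: "(\<lambda>k. r ^ k / fact k * exp (- r) * s ^ k) sums (exp (r * s) * exp (- r))"
    using sums_mult2[OF exp_converges[of "r * s"], of "exp (- r)"]
    by (simp add: power_mult_distrib field_simps)
  have "(\<integral>\<^sup>+k. ennreal (s ^ k) \<partial>measure_pmf (poisson_pmf r)) = (\<Sum>k. ennreal (pmf (poisson_pmf r) k) * ennreal (s ^ k))"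
    by (simp add: nn_integral_measure_pmf nn_integral_count_space_nat)
  also have "\<dots> = (\<Sum>k. ennreal (r ^ k / fact k * exp (- r) * s ^ k))"
    using assms by (simp add: ennreal_mult[symmetric] del: ennreal_power)
  also have "\<dots> = ennreal (exp (r * s) * exp (- r))"
    using assms sums by (intro suminf_ennreal_eq) auto
  finally show ?thesis
    by (simp add: exp_diff exp_minus field_simps)
qed

text \<open>Markov's inequality for \<open>2 ^ k\<close>, whose mean is
  \<open>exp r\<close>.\<close>

lemma prob_poisson_ge:
  assumes "0 < r"
  shows "measure (measure_pmf (poisson_pmf r)) {n..} \<le> exp r / 2 ^ n"
proof -
  have "emeasure (measure_pmf (poisson_pmf r)) {n..} = (\<integral>\<^sup>+k. indicator {n..} k \<partial>measure_pmf (poisson_pmf r))"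
    by simp
  also have "\<dots> \<le> (\<integral>\<^sup>+k. ennreal (1 / 2 ^ n) * ennreal (2 ^ k) \<partial>measure_pmf (poisson_pmf r))"
    by (intro nn_integral_mono) (auto simp: indicator_def ennreal_mult[symmetric] power_increasing simp flip: ennreal_1 intro!: ennreal_leI)
  also have "\<dots> = ennreal (1 / 2 ^ n) * ennreal (exp (r * 2 - r))"
    using assms by (simp add: nn_integral_cmult nn_integral_power_poisson_pmf)
  also have "\<dots> = ennreal (exp r / 2 ^ n)"
    by (simp add: ennreal_mult[symmetric] field_simps)
  finally show ?thesis
    by (simp add: measure_pmf.emeasure_eq_measure)
qed

text \<open>Markov's inequality for \<open>(1 / 2) ^ k\<close>, whose mean is
  \<open>exp (- (r / 2))\<close>.\<close>

lemma prob_poisson_less: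
  assumes "0 < r"
  shows "measure (measure_pmf (poisson_pmf r)) {..<n} \<le> 2 ^ n * exp (- (r / 2))"
proof -
  have "emeasure (measure_pmf (poisson_pmf r)) {..<n} = (\<integral>\<^sup>+k. indicator {..<n} k \<partial>measure_pmf (poisson_pmf r))"
    by simp
  also have "\<dots> \<le> (\<integral>\<^sup>+k. ennreal (2 ^ n) * ennreal ((1 / 2) ^ k) \<partial>measure_pmf (poisson_pmf r))"
  proof (intro nn_integral_mono)
    fix k
    have "(1::real) \<le> 2 ^ n * (1 / 2) ^ k" if "k < n"
      using that by (simp add: power_one_over field_simps power_increasing)
    then show "indicator {..<n} k \<le> ennreal (2 ^ n) * ennreal ((1 / 2) ^ k)"
      by (auto simp: indicator_def ennreal_mult[symmetric] simp flip: ennreal_1 intro!: ennreal_leI)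
  qed
  also have "\<dots> = ennreal (2 ^ n) * ennreal (exp (r * (1 / 2) - r))"
    using assms by (simp add: nn_integral_cmult nn_integral_power_poisson_pmf del: ennreal_power)
  also have "\<dots> = ennreal (2 ^ n * exp (- (r / 2)))"
    by (simp add: ennreal_mult[symmetric] field_simps)
  finally show ?thesis
    by (simp add: measure_pmf.emeasure_eq_measure)
qed

context prob_space begin

lemma poisson_process_prob:
  assumes N: "poisson_process 1 N" and t: "0 < t"
  shows "prob {\<omega> \<in> space M. N t \<omega> \<in> A} = measure (measure_pmf (poisson_pmf t)) A"
proof -
  have N0: "\<forall>\<omega>\<in>space M. N 0 \<omega> = 0" and
    rv: "\<And>t. 0 \<le> t \<Longrightarrow> random_variable (count_space UNIV) (N t)" and
    d: "distr M (count_space UNIV) (\<lambda>\<omega>. N t \<omega> - N 0 \<omega>) = measure_pmf (poisson_pmf (1 * (t - 0)))"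
    using N t unfolding poisson_process_def by blast+
  have "random_variable (count_space UNIV) (N t)"
    using rv t by simp
  moreover have "distr M (count_space UNIV) (N t) = distr M (count_space UNIV) (\<lambda>\<omega>. N t \<omega> - N 0 \<omega>)"
    using N0 by (intro distr_cong) auto
  ultimately have "measure (measure_pmf (poisson_pmf t)) A = measure (distr M (count_space UNIV) (N t)) A"
    using d by simp
  also have "\<dots> = prob {\<omega> \<in> space M. N t \<omega> \<in> A}"
    using rv[of t] t by (subst measure_distr) (auto simp: vimage_def Int_def conj_commute)
  finally show ?thesis ..
qed

lemma poisson_process_event:
  assumes N: "poisson_process 1 N" and t: "0 \<le> t"
  shows "{\<omega> \<in> space M. N t \<omega> \<in> A} \<in> events"
proof -
  have "random_variable (count_space UNIV) (N t)"
    using N t unfolding poisson_process_def by blast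
  then have "N t -` A \<inter> space M \<in> events"
    by (rule measurable_sets) simp
  then show ?thesis
    by (simp add: vimage_def Int_def conj_commute)
qed

text \<open>A crude law of large numbers. The arrival is late only if too few points have come by
  time \<open>2 * real (Suc i)\<close>, and early only if too many have come before
  \<open>real (Suc i) / 2\<close>. The Chernoff bounds make both probabilities geometrically small,
  and the first Borel-Cantelli lemma applies.\<close>

lemma AE_arrival_time_bounds:
  assumes N: "poisson_process 1 N"
  shows "AE \<omega> in M. \<forall>\<^sub>F i in sequentially.
    real (Suc i) / 2 \<le> arrival_time N i \<omega> \<and> arrival_time N i \<omega> \<le> 2 * real (Suc i)"
proof -
  let ?B = "\<lambda>i. {\<omega> \<in> space M. N (2 * real (Suc i)) \<omega> \<in> {..<Suc i}}"
  let ?C = "\<lambda>i. {\<omega> \<in> space M. N (real (Suc i) / 2) \<omega> \<in> {Suc i..}}"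
  have B: "prob (?B i) \<le> (2 / exp 1) ^ Suc i" for i
  proof -
    have "prob (?B i) \<le> 2 ^ Suc i * exp (- (2 * real (Suc i) / 2))"
      using prob_poisson_less[of "2 * real (Suc i)" "Suc i"] by (subst poisson_process_prob[OF N]) simp_all
    also have "\<dots> = (2 / exp 1) ^ Suc i"
      by (simp only: power_divide exp_of_nat_mult[symmetric] exp_minus) (simp add: field_simps)
    finally show ?thesis .
  qed
  have C: "prob (?C i) \<le> (exp (1 / 2) / 2) ^ Suc i" for i
  proof -
    have "prob (?C i) \<le> exp (real (Suc i) / 2) / 2 ^ Suc i"
      using prob_poisson_ge[of "real (Suc i) / 2" "Suc i"] by (subst poisson_process_prob[OF N]) simp_all
    also have "\<dots> = (exp (1 / 2) / 2) ^ Suc i"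
      by (simp only: power_divide exp_of_nat_mult[symmetric]) simp
    finally show ?thesis .
  qed
  \<comment> \<open>Both geometric ratios are below 1 because \<open>2 < exp 1 < 4\<close>: the
    lower bound is \<open>(1 + 1 / 2)\<^sup>2 \<le> exp 1\<close>, the upper one
    \<open>exp 1 \<le> 3\<close>.\<close>
  have e: "2 < exp (1::real)"
    using exp_ge_one_plus_x_over_n_power_n[of 2 1] by (simp add: power2_eq_square)
  have e2: "exp (1 / 2) < (2::real)"
  proof -
    have "(exp (1 / 2))\<^sup>2 = exp (1::real)"
      by (simp add: exp_double[symmetric])
    also have "\<dots> < 2\<^sup>2"
      using exp_le by simp
    finally show ?thesis
      by (rule power2_less_imp_less) simp
  qed
  have "AE \<omega> in M. \<forall>\<^sub>F i in sequentially. \<omega> \<in> space M - ?B i"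
  proof (rule borel_cantelli_AE1)
    show "summable (\<lambda>i. prob (?B i))"
      by (rule summable_comparison_test'[OF summable_ignore_initial_segment[OF summable_geometric[of "2 / exp 1"], of 1], of 0])
         (use e B in simp_all)
    show "?B i \<in> events" for i
      by (rule poisson_process_event[OF N]) simp
  qed (simp add: less_top[symmetric])
  moreover have "AE \<omega> in M. \<forall>\<^sub>F i in sequentially. \<omega> \<in> space M - ?C i"
  proof (rule borel_cantelli_AE1)
    show "summable (\<lambda>i. prob (?C i))"
      by (rule summable_comparison_test'[OF summable_ignore_initial_segment[OF summable_geometric[of "exp (1 / 2) / 2"], of 1], of 0])
         (use e2 C in simp_all)
    show "?C i \<in> events" for i
      by (rule poisson_process_event[OF N]) simp
  qed (simp add: less_top[symmetric])
  ultimately show ?thesis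
    using AE_space
  proof eventually_elim
    fix \<omega>
    assume BC: "\<forall>\<^sub>F i in sequentially. \<omega> \<in> space M - ?B i" "\<forall>\<^sub>F i in sequentially. \<omega> \<in> space M - ?C i"
      and \<omega>: "\<omega> \<in> space M"
    have mono: "mono_on {0..} (\<lambda>t. N t \<omega>)"
      using N \<omega> unfolding poisson_process_def by blast
    show "\<forall>\<^sub>F i in sequentially. real (Suc i) / 2 \<le> arrival_time N i \<omega> \<and> arrival_time N i \<omega> \<le> 2 * real (Suc i)"
      using BC
    proof eventually_elim
      fix i
      assume "\<omega> \<in> space M - ?B i" "\<omega> \<in> space M - ?C i"
      then have b: "Suc i \<le> N (2 * real (Suc i)) \<omega>" and c: "N (real (Suc i) / 2) \<omega> < Suc i"
        by (auto simp: not_less)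
      let ?T = "{t. 0 \<le> t \<and> Suc i \<le> N t \<omega>}"
      \<comment> \<open>Besides giving the upper bound, this witness shows that the set is nonempty;
        the infimum of the empty set would carry no information.\<close>
      have mem: "2 * real (Suc i) \<in> ?T"
        using b by simp
      have "real (Suc i) / 2 \<le> t" if "t \<in> ?T" for t
      proof (rule ccontr)
        assume "\<not> real (Suc i) / 2 \<le> t"
        then have "N t \<omega> \<le> N (real (Suc i) / 2) \<omega>"
          using that by (intro mono_onD[OF mono]) auto
        then show False
          using that c by simp
      qed
      then have "real (Suc i) / 2 \<le> Inf ?T"
        using mem by (intro cInf_greatest) blast+
      moreover have "Inf ?T \<le> 2 * real (Suc i)"
        by (rule cInf_lower[OF mem]) (auto simp: bdd_below_def)
      ultimately show "real (Suc i) / 2 \<le> arrival_time N i \<omega> \<and> arrival_time N i \<omega> \<le> 2 * real (Suc i)"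
        by (simp add: arrival_time_def)
    qed
  qed
qed

end

section \<open>The distribution of the jump locations\<close>

text \<open>The index \<open>j\<close> with \<open>x\<close> in \<open>unit_shell (Suc j)\<close>.
  Both halves of a shell are closed on the left, so the negative half-line needs a ceiling:
  \<open>- 1\<close> lies in the first shell, \<open>1\<close> in the second.\<close>

definition shell_index :: "real \<Rightarrow> nat" where
  "shell_index x = (if 0 \<le> x then nat \<lfloor>x\<rfloor> else nat (\<lceil>- x\<rceil> - 1))"

lemma mem_unit_shell_Suc_iff: "x \<in> unit_shell (Suc j) \<longleftrightarrow> j = shell_index x"
proof (cases "0 \<le> x")
  case True
  then have "x \<in> unit_shell (Suc j) \<longleftrightarrow> \<lfloor>x\<rfloor> = int j"
    by (auto simp: unit_shell_def floor_eq_iff)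
  then show ?thesis
    using True by (auto simp: shell_index_def)
next
  case False
  then have "x \<in> unit_shell (Suc j) \<longleftrightarrow> \<lceil>- x\<rceil> = int j + 1"
    by (auto simp: unit_shell_def ceiling_eq_iff)
  moreover have "1 \<le> \<lceil>- x\<rceil>"
    using False by (simp add: le_ceiling_iff)
  ultimately show ?thesis
    using False by (auto simp: shell_index_def)
qed

lemma shell_index_bounds: "\<bar>x\<bar> \<le> real (Suc (shell_index x))" "real (Suc (shell_index x)) \<le> \<bar>x\<bar> + 1"
proof -
  have "x \<in> unit_shell (Suc (shell_index x))"
    by (simp add: mem_unit_shell_Suc_iff)
  then show "\<bar>x\<bar> \<le> real (Suc (shell_index x))" "real (Suc (shell_index x)) \<le> \<bar>x\<bar> + 1"
    by (auto simp: unit_shell_def)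
qed

text \<open>The shells partition the line. This collapses both the series for the density and the
  inner series of the field.\<close>

lemma suminf_shell:
  fixes f :: "nat \<Rightarrow> real"
  shows "(\<Sum>j. f j * indicator (unit_shell (Suc j)) x) = f (shell_index x)"
proof -
  have "(\<lambda>j. f j * indicator (unit_shell (Suc j)) x) = (\<lambda>j. if j = shell_index x then f (shell_index x) else 0)"
    by (auto simp: fun_eq_iff mem_unit_shell_Suc_iff indicator_def)
  then show ?thesis
    using sums_single[of "shell_index x" "\<lambda>_. f (shell_index x)"] by (simp add: sums_iff)
qed

lemma sets_unit_shell [measurable]: "unit_shell j \<in> sets borel"
  by (simp add: unit_shell_def)

lemma m_hat_density_eq: "m_hat_density x = 3 / pi\<^sup>2 / (real (Suc (shell_index x)))\<^sup>2"
  unfolding m_hat_density_def by (subst suminf_shell) simp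

text \<open>The lower bound keeps the density away from 0 near \<open>t\<close>; the upper bound
  yields moments of order below 1. Its constant arises as \<open>1 / 2 * 4\<close>, from
  \<open>3 / pi\<^sup>2 \<le> 1 / 2\<close> and from \<open>1 + \<bar>x\<bar>\<close> being at most
  twice the shell number.\<close>

lemma m_hat_density_bounds:
  "3 / pi\<^sup>2 / (1 + \<bar>x\<bar>)\<^sup>2 \<le> m_hat_density x" "m_hat_density x \<le> 2 * (1 + \<bar>x\<bar>) powr (- 2)"
proof -
  let ?m = "real (Suc (shell_index x))"
  note b = shell_index_bounds[of x]
  have "?m\<^sup>2 \<le> (1 + \<bar>x\<bar>)\<^sup>2"
    using b by (intro power_mono) auto
  then show "3 / pi\<^sup>2 / (1 + \<bar>x\<bar>)\<^sup>2 \<le> m_hat_density x"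
    unfolding m_hat_density_eq by (intro divide_left_mono) auto
  have "(1 + \<bar>x\<bar>)\<^sup>2 \<le> (2 * ?m)\<^sup>2"
    using b by (intro power_mono) auto
  then have "4 / (2 * ?m)\<^sup>2 \<le> 4 / (1 + \<bar>x\<bar>)\<^sup>2"
    by (intro divide_left_mono mult_pos_pos zero_less_power) auto
  then have "1 / ?m\<^sup>2 \<le> 4 / (1 + \<bar>x\<bar>)\<^sup>2"
    by (simp only: power_mult_distrib) simp
  moreover have "3\<^sup>2 \<le> pi\<^sup>2"
    using pi_gt3 by (intro power_mono) auto
  then have "3 / pi\<^sup>2 \<le> 1 / 2"
    by (simp add: divide_simps)
  ultimately have "3 / pi\<^sup>2 * (1 / ?m\<^sup>2) \<le> 1 / 2 * (4 / (1 + \<bar>x\<bar>)\<^sup>2)"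
    by (intro mult_mono) auto
  moreover have "(1 + \<bar>x\<bar>) powr (- 2) = 1 / (1 + \<bar>x\<bar>)\<^sup>2"
    by (simp add: powr_minus_divide powr_realpow)
  ultimately show "m_hat_density x \<le> 2 * (1 + \<bar>x\<bar>) powr (- 2)"
    unfolding m_hat_density_eq by simp
qed

lemma m_hat_density_measurable [measurable]: "m_hat_density \<in> borel_measurable borel"
  unfolding m_hat_density_def[abs_def] by measurable

lemma nn_integral_powr_abs_finite:
  fixes p :: real
  assumes p: "p < - 1"
  shows "(\<integral>\<^sup>+x. ennreal ((1 + \<bar>x\<bar>) powr p) \<partial>lborel) < \<infinity>"
proof -
  let ?h = "\<lambda>x::real. ennreal ((1 + \<bar>x\<bar>) powr p)"
  let ?F = "\<lambda>x::real. (1 + x) powr (p + 1) / (p + 1)"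
  have "(\<integral>\<^sup>+x. ?h x * indicator {0..} x \<partial>lborel) = ennreal (0 - ?F 0)"
  proof (rule nn_integral_FTC_atLeast)
    show "DERIV ?F x :> (1 + \<bar>x\<bar>) powr p" if "0 \<le> x" for x
      using that p by (auto intro!: derivative_eq_intros)
    show "(?F \<longlongrightarrow> 0) at_top"
    proof -
      have "((\<lambda>x. (1 + x) powr (p + 1)) \<longlongrightarrow> 0) at_top"
        using p by (intro tendsto_neg_powr filterlim_tendsto_add_at_top[OF tendsto_const] filterlim_ident) auto
      then show ?thesis
        by (rule tendsto_divide_zero)
    qed
  qed auto
  then have fin: "(\<integral>\<^sup>+x. ?h x * indicator {0..} x \<partial>lborel) < \<infinity>"
    by simp
  have "(\<integral>\<^sup>+x. ?h x \<partial>lborel) \<le> (\<integral>\<^sup>+x. ?h x * indicator {0..} x + ?h x * indicator {..0} x \<partial>lborel)"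
    by (intro nn_integral_mono) (auto simp: indicator_def)
  also have "\<dots> = (\<integral>\<^sup>+x. ?h x * indicator {0..} x \<partial>lborel) + (\<integral>\<^sup>+x. ?h x * indicator {..0} x \<partial>lborel)"
    by (rule nn_integral_add) auto
  also have "(\<integral>\<^sup>+x. ?h x * indicator {..0} x \<partial>lborel) = (\<integral>\<^sup>+x. ?h x * indicator {0..} x \<partial>lborel)"
    by (subst nn_integral_real_affine[where c = "- 1" and t = 0]) (auto simp: indicator_def intro!: nn_integral_cong)
  finally show ?thesis
    using fin by (metis (no_types, lifting) ennreal_add_eq_top infinity_ennreal_def less_top top.extremum_unique)
qed

context prob_space begin

lemma m_hat_AE_neq:
  assumes "distributed M lborel X (\<lambda>x. ennreal (m_hat_density x))"
  shows "AE \<omega> in M. X \<omega> \<noteq> c"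
proof -
  have "AE x in density lborel (\<lambda>x. ennreal (m_hat_density x)). x \<noteq> c"
    by (subst AE_density) (auto intro: eventually_mono[OF AE_lborel_singleton[of c]])
  then have "AE x in distr M lborel X. x \<noteq> c"
    by (simp only: distributed_distr_eq_density[OF assms])
  with distributed_measurable[OF assms] show ?thesis
    by (rule AE_distrD)
qed

text \<open>A bound linear in \<open>r\<close>, so that radii with divergent sum lead to a divergent
  series of probabilities. On the ball \<open>1 + \<bar>x\<bar> \<le> 2 + \<bar>t\<bar>\<close>,
  since \<open>r \<le> 1\<close>; the ball has length \<open>2 * r\<close>.\<close>

lemma m_hat_prob_ball:
  assumes X: "distributed M lborel X (\<lambda>x. ennreal (m_hat_density x))" and r: "0 \<le> r" "r \<le> 1"
  shows "6 / pi\<^sup>2 / (2 + \<bar>t\<bar>)\<^sup>2 * r \<le> prob (X -` {t - r..t + r} \<inter> space M)"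
proof -
  let ?k = "3 / pi\<^sup>2 / (2 + \<bar>t\<bar>)\<^sup>2"
  have "ennreal (?k * (2 * r)) = ennreal ?k * emeasure lborel {t - r..t + r}"
    using r by (simp add: ennreal_mult[symmetric] algebra_simps)
  also have "\<dots> = (\<integral>\<^sup>+x. ennreal ?k * indicator {t - r..t + r} x \<partial>lborel)"
    by (simp add: nn_integral_cmult_indicator)
  also have "\<dots> \<le> (\<integral>\<^sup>+x. ennreal (m_hat_density x) * indicator {t - r..t + r} x \<partial>lborel)"
  proof (rule nn_integral_mono)
    fix x
    show "ennreal ?k * indicator {t - r..t + r} x \<le> ennreal (m_hat_density x) * indicator {t - r..t + r} x"
    proof (cases "x \<in> {t - r..t + r}")
      case True
      then have "(1 + \<bar>x\<bar>)\<^sup>2 \<le> (2 + \<bar>t\<bar>)\<^sup>2"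
        using r by (intro power_mono) auto
      then have "?k \<le> 3 / pi\<^sup>2 / (1 + \<bar>x\<bar>)\<^sup>2"
        by (intro divide_left_mono) auto
      also have "\<dots> \<le> m_hat_density x"
        by (rule m_hat_density_bounds)
      finally show ?thesis
        using True by (simp add: ennreal_leI)
    qed simp
  qed
  also have "\<dots> = emeasure M (X -` {t - r..t + r} \<inter> space M)"
    using X by (intro distributed_emeasure[symmetric]) auto
  finally have "?k * (2 * r) \<le> prob (X -` {t - r..t + r} \<inter> space M)"
    using r by (simp add: emeasure_eq_measure)
  then show ?thesis
    by simp
qed

lemma m_hat_moment:
  assumes X: "distributed M lborel X (\<lambda>x. ennreal (m_hat_density x))"
  shows "(\<integral>\<^sup>+\<omega>. ennreal ((1 + \<bar>X \<omega>\<bar>) powr \<theta>) \<partial>M) \<le> 2 * (\<integral>\<^sup>+x. ennreal ((1 + \<bar>x\<bar>) powr (\<theta> - 2)) \<partial>lborel)"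
proof -
  have "(\<integral>\<^sup>+\<omega>. ennreal ((1 + \<bar>X \<omega>\<bar>) powr \<theta>) \<partial>M) =
      (\<integral>\<^sup>+x. ennreal (m_hat_density x) * ennreal ((1 + \<bar>x\<bar>) powr \<theta>) \<partial>lborel)"
    using X by (intro distributed_nn_integral[symmetric]) auto
  also have "\<dots> \<le> (\<integral>\<^sup>+x. 2 * ennreal ((1 + \<bar>x\<bar>) powr (\<theta> - 2)) \<partial>lborel)"
  proof (rule nn_integral_mono)
    fix x :: real
    have "m_hat_density x * (1 + \<bar>x\<bar>) powr \<theta> \<le> (2 * (1 + \<bar>x\<bar>) powr (- 2)) * (1 + \<bar>x\<bar>) powr \<theta>"
      by (intro mult_right_mono m_hat_density_bounds) simp
    also have "\<dots> = 2 * (1 + \<bar>x\<bar>) powr (\<theta> - 2)"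
      by (simp add: powr_diff powr_minus field_simps)
    finally have "ennreal (m_hat_density x * (1 + \<bar>x\<bar>) powr \<theta>) \<le> ennreal (2 * (1 + \<bar>x\<bar>) powr (\<theta> - 2))"
      by (rule ennreal_leI)
    then show "ennreal (m_hat_density x) * ennreal ((1 + \<bar>x\<bar>) powr \<theta>) \<le> 2 * ennreal ((1 + \<bar>x\<bar>) powr (\<theta> - 2))"
      by (simp add: ennreal_mult' ennreal_mult'')
  qed
  also have "\<dots> = 2 * (\<integral>\<^sup>+x. ennreal ((1 + \<bar>x\<bar>) powr (\<theta> - 2)) \<partial>lborel)"
    by (rule nn_integral_cmult) simp
  finally show ?thesis .
qed

text \<open>By Tonelli the expected sum is at most the convergent series of
  \<open>real (Suc i) powr (- q)\<close> times a common bound for the moments of order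
  \<open>\<theta>\<close>, finite because the density decays like
  \<open>(1 + \<bar>x\<bar>) powr (- 2)\<close> and \<open>\<theta> < 1\<close>.\<close>

lemma AE_m_hat_summable:
  assumes V: "\<And>i. distributed M lborel (V i) (\<lambda>x. ennreal (m_hat_density x))"
    and q: "1 < q" and \<theta>: "\<theta> < 1"
  shows "AE \<omega> in M. summable (\<lambda>i. real (Suc i) powr (- q) * (1 + \<bar>V i \<omega>\<bar>) powr \<theta>)"
proof -
  let ?I = "2 * (\<integral>\<^sup>+x. ennreal ((1 + \<bar>x\<bar>) powr (\<theta> - 2)) \<partial>lborel)"
  have [measurable]: "random_variable borel (V i)" for i
    using distributed_measurable[OF V[of i]] by simp
  have I: "?I < \<infinity>"
    using nn_integral_powr_abs_finite[of "\<theta> - 2"] \<theta> by (simp add: ennreal_mult_less_top)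
  have q_sum: "summable (\<lambda>i. real (Suc i) powr (- q))"
    using q by (subst summable_Suc_iff) (simp add: summable_real_powr_iff)
  have "(\<integral>\<^sup>+\<omega>. (\<Sum>i. ennreal (real (Suc i) powr (- q) * (1 + \<bar>V i \<omega>\<bar>) powr \<theta>)) \<partial>M) =
      (\<Sum>i. \<integral>\<^sup>+\<omega>. ennreal (real (Suc i) powr (- q) * (1 + \<bar>V i \<omega>\<bar>) powr \<theta>) \<partial>M)"
    by (rule nn_integral_suminf) measurable
  also have "\<dots> \<le> (\<Sum>i. ennreal (real (Suc i) powr (- q)) * ?I)"
  proof (intro suminf_le)
    fix i
    have "(\<integral>\<^sup>+\<omega>. ennreal (real (Suc i) powr (- q) * (1 + \<bar>V i \<omega>\<bar>) powr \<theta>) \<partial>M) =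
       ennreal (real (Suc i) powr (- q)) * (\<integral>\<^sup>+\<omega>. ennreal ((1 + \<bar>V i \<omega>\<bar>) powr \<theta>) \<partial>M)"
      by (subst nn_integral_cmult[symmetric]) (auto simp: ennreal_mult)
    also have "\<dots> \<le> ennreal (real (Suc i) powr (- q)) * ?I"
      by (intro mult_left_mono m_hat_moment V) simp
    finally show "(\<integral>\<^sup>+\<omega>. ennreal (real (Suc i) powr (- q) * (1 + \<bar>V i \<omega>\<bar>) powr \<theta>) \<partial>M) \<le> ennreal (real (Suc i) powr (- q)) * ?I" .
  qed auto
  also have "\<dots> = (\<Sum>i. ennreal (real (Suc i) powr (- q))) * ?I"
    by simp
  also have "(\<Sum>i. ennreal (real (Suc i) powr (- q))) = ennreal (\<Sum>i. real (Suc i) powr (- q))"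
    using q_sum by (intro suminf_ennreal2) auto
  also have "\<dots> * ?I < \<infinity>"
    using I by (simp add: ennreal_mult_less_top)
  finally have "AE \<omega> in M. (\<Sum>i. ennreal (real (Suc i) powr (- q) * (1 + \<bar>V i \<omega>\<bar>) powr \<theta>)) \<noteq> \<infinity>"
    by (intro nn_integral_PInf_AE) auto
  then show ?thesis
    by eventually_elim (rule summable_suminf_not_top, auto)
qed

text \<open>The second Borel-Cantelli argument: by independence and
  \<open>1 - y \<le> exp (- y)\<close>, missing all balls with indices from \<open>n\<close> to
  \<open>n + m\<close> has probability at most the exponential of minus a constant times a piece of
  the harmonic series.\<close>

lemma AE_m_hat_infinitely_often_near:
  assumes V: "\<And>i. distributed M lborel (V i) (\<lambda>x. ennreal (m_hat_density x))"
    and indep: "indep_vars (\<lambda>_. borel) V UNIV"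
  shows "AE \<omega> in M. \<exists>\<^sub>\<infinity>i. \<bar>V i \<omega> - t\<bar> \<le> 1 / real (Suc i)"
proof -
  define k where "k = 6 / pi\<^sup>2 / (2 + \<bar>t\<bar>)\<^sup>2"
  have k: "0 < k"
    by (auto simp: k_def intro!: divide_pos_pos zero_less_power)
  let ?r = "\<lambda>i. 1 / real (Suc i)"
  let ?A = "\<lambda>i. - {t - ?r i..t + ?r i}"
  have rv [measurable]: "random_variable borel (V i)" for i
    using distributed_measurable[OF V[of i]] by simp
  have pA: "prob (V i -` ?A i \<inter> space M) \<le> exp (- (k * ?r i))" for i
  proof -
    have "V i -` ?A i \<inter> space M = space M - (V i -` {t - ?r i..t + ?r i} \<inter> space M)"
      by auto
    then have "prob (V i -` ?A i \<inter> space M) = 1 - prob (V i -` {t - ?r i..t + ?r i} \<inter> space M)"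
      by (simp add: prob_compl measurable_sets[OF rv])
    also have "\<dots> \<le> 1 - k * ?r i"
      using m_hat_prob_ball[OF V[of i], of "?r i" t] by (simp add: k_def)
    also have "\<dots> \<le> exp (- (k * ?r i))"
      using exp_ge_add_one_self[of "- (k * ?r i)"] by linarith
    finally show ?thesis .
  qed
  have "AE \<omega> in M. \<exists>i\<ge>n. V i \<omega> \<in> {t - ?r i..t + ?r i}" for n
  proof -
    define B where "B = {\<omega> \<in> space M. \<forall>i\<ge>n. V i \<omega> \<in> ?A i}"
    have [measurable]: "B \<in> events"
      unfolding B_def by measurable
    have le: "prob B \<le> exp (- k * (\<Sum>i\<in>{n..n + m}. ?r i))" for m
    proof -
      have "prob B \<le> prob (\<Inter>i\<in>{n..n + m}. V i -` ?A i \<inter> space M)"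
        unfolding B_def by (intro finite_measure_mono) (auto intro!: sets.finite_INT measurable_sets[OF rv])
      also have "\<dots> = (\<Prod>i\<in>{n..n + m}. prob (V i -` ?A i \<inter> space M))"
        by (rule indep_varsD[OF indep]) auto
      also have "\<dots> \<le> (\<Prod>i\<in>{n..n + m}. exp (- (k * ?r i)))"
        by (intro prod_mono) (use pA in auto)
      also have "\<dots> = exp (- k * (\<Sum>i\<in>{n..n + m}. ?r i))"
        by (simp add: exp_sum[symmetric] sum_negf sum_distrib_left)
      finally show ?thesis .
    qed
    \<comment> \<open>If \<open>B\<close> had positive probability, taking logarithms would bound
      the partial sums of the harmonic series by \<open>- ln (prob B) / k\<close>.\<close>
    have "prob B = 0"
    proof (rule ccontr)
      assume "prob B \<noteq> 0"
      then have pos: "0 < prob B"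
        using measure_nonneg[of M B] by linarith
      have "(\<Sum>i<m. ?r (i + n)) \<le> - ln (prob B) / k" for m
      proof -
        have "ln (prob B) \<le> - k * (\<Sum>i\<in>{n..n + m}. ?r i)"
          using le[of m] pos by (metis exp_gt_zero ln_exp ln_le_cancel_iff)
        then have "(\<Sum>i\<in>{n..n + m}. ?r i) \<le> - ln (prob B) / k"
          using k by (simp add: field_simps)
        moreover have "(\<Sum>i<m. ?r (i + n)) \<le> (\<Sum>i\<in>{n..n + m}. ?r i)"
        proof -
          have "(\<Sum>i<m. ?r (i + n)) = (\<Sum>i\<in>{n..<n + m}. ?r i)"
            by (rule sum.reindex_bij_witness[of _ "\<lambda>i. i - n" "\<lambda>i. i + n"]) auto
          also have "\<dots> \<le> (\<Sum>i\<in>{n..n + m}. ?r i)"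
            by (rule sum_mono2) auto
          finally show ?thesis .
        qed
        ultimately show ?thesis
          by linarith
      qed
      then have "summable (\<lambda>i. ?r (i + n))"
        by (intro summableI_nonneg_bounded) auto
      then have "summable ?r"
        by (rule summable_iff_shift[THEN iffD1])
      then have "summable (\<lambda>i. inverse (real (Suc i)))"
        by (simp add: inverse_eq_divide)
      then have "summable (\<lambda>i. inverse (real i))"
        by (rule summable_Suc_iff[THEN iffD1])
      then show False
        using not_summable_harmonic[where 'a = real] by simp
    qed
    then have "AE \<omega> in M. \<omega> \<notin> B"
      by (simp add: prob_eq_0)
    with AE_space show ?thesis
      by eventually_elim (auto simp: B_def)
  qed
  then have "AE \<omega> in M. \<forall>n. \<exists>i\<ge>n. V i \<omega> \<in> {t - ?r i..t + ?r i}"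
    unfolding AE_all_countable by blast
  then show ?thesis
    by eventually_elim (force simp: INFM_nat_le abs_le_iff)
qed

end

section \<open>The kernel of the series\<close>

text \<open>For \<open>y \<le> x\<close>, \<open>y * x powr (b - 1) \<le> y powr b\<close> because
  \<open>b - 1 \<le> 0\<close>; subtracting this from \<open>x * x powr (b - 1) = x powr b\<close>
  gives the bound. The factor at the larger argument provides decay at infinity and stays harmless
  when the smaller argument is 0, even for \<open>b = 0\<close>, where
  \<open>0 powr 0 = 0\<close>.\<close>

lemma abs_powr_diff_le:
  fixes x y b :: real
  assumes "0 \<le> x" "0 \<le> y" "0 \<le> b" "b \<le> 1"
  shows "\<bar>x powr b - y powr b\<bar> \<le> \<bar>x - y\<bar> * max x y powr (b - 1)"
proof -
  have *: "\<bar>x powr b - y powr b\<bar> \<le> \<bar>x - y\<bar> * max x y powr (b - 1)" if "0 \<le> y" "y \<le> x" for x y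
  proof (cases "y = 0")
    case True
    then show ?thesis
      using that by (cases "x = 0") (auto simp: powr_diff)
  next
    case False
    then have pos: "0 < y" "0 < x"
      using that by auto
    have "y * x powr (b - 1) \<le> y * y powr (b - 1)"
      using that assms pos by (intro mult_left_mono powr_mono2') auto
    moreover have "y * y powr (b - 1) = y powr b" "x * x powr (b - 1) = x powr b"
      using pos by (auto simp: powr_diff)
    moreover have "y powr b \<le> x powr b"
      using that assms by (intro powr_mono2) auto
    ultimately show ?thesis
      using that by (simp add: max_def left_diff_distrib)
  qed
  show ?thesis
    using *[of y x] *[of x y] assms by (cases "y \<le> x") (simp_all add: abs_minus_commute max.commute)
qed

text \<open>
  The second moment of the kernel at a random location may be infinite, so we pass through \<open>p\<close>-th
  powers for some \<open>1 / A < p < 2\<close>.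
\<close>

lemma square_summable_scaled_kernel:
  fixes A b s :: real and g v :: "nat \<Rightarrow> real"
  assumes A: "1 / 2 < A" and b: "0 \<le> b" and Ab: "A + b < 1"
    and g: "\<forall>\<^sub>F i in sequentially. real (Suc i) / 2 \<le> g i"
    and v: "\<And>n. summable (\<lambda>i. real (Suc i) powr (- (1 + 1 / real (Suc n))) * (1 + \<bar>v i\<bar>) powr (1 - 1 / real (Suc n)))"
  shows "summable (\<lambda>i. ((pi\<^sup>2 * (real (Suc (shell_index (v i))))\<^sup>2 / 3) powr A * g i powr (- A) *
            (\<bar>s - v i\<bar> powr b - \<bar>v i\<bar> powr b))\<^sup>2)"
proof -
  \<comment> \<open>The growth exponent of the terms in \<open>1 + \<bar>v i\<bar>\<close>: the
    shell number contributes \<open>2 * A\<close>, the increment of the power \<open>b - 1\<close>.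
    The condition \<open>A + b < 1\<close> says exactly that \<open>e < A\<close>.\<close>
  define e where "e = 2 * A + b - 1"
  \<comment> \<open>The reciprocal of the midpoint between \<open>max (1 / 2) e\<close> and
    \<open>A\<close>, which yields \<open>p < 2\<close>, \<open>p * A > 1\<close> and
    \<open>p * e < 1\<close> together.\<close>
  define p where "p = 2 / (max (1 / 2) e + A)"
  define x where "x i = real (Suc i) powr (- A) * (1 + \<bar>v i\<bar>) powr e" for i
  have eA: "e < A"
    using Ab by (simp add: e_def)
  have p: "0 < p" "p < 2" "1 < p * A" "p * e < 1"
    using A eA by (auto simp: p_def field_simps max_def)
  \<comment> \<open>The exponents \<open>A\<close> and \<open>b\<close> will be values at a varying
    point \<open>s\<close>. A family indexed by \<open>n\<close> lets one exceptional null set serve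
    all of them: some member always dominates the \<open>p\<close>-th powers of
    \<open>x\<close>.\<close>
  obtain n where n: "1 / real (Suc n) < min (p * A - 1) (1 - p * e)"
    using nat_approx_posE[of "min (p * A - 1) (1 - p * e)"] p by auto
  have "summable (\<lambda>i. x i powr p)"
  proof (rule summable_comparison_test'[OF v[of n], of 0])
    fix i
    have "x i powr p = real (Suc i) powr (- (p * A)) * (1 + \<bar>v i\<bar>) powr (p * e)"
      by (simp add: x_def powr_mult powr_powr mult.commute)
    also have "\<dots> \<le> real (Suc i) powr (- (1 + 1 / real (Suc n))) * (1 + \<bar>v i\<bar>) powr (1 - 1 / real (Suc n))"
      using n by (intro mult_mono powr_mono) auto
    finally show "norm (x i powr p) \<le> real (Suc i) powr (- (1 + 1 / real (Suc n))) * (1 + \<bar>v i\<bar>) powr (1 - 1 / real (Suc n))"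
      by simp
  qed
  \<comment> \<open>The \<open>p\<close>-th powers tend to 0, so eventually
    \<open>x i \<le> 1\<close>, and there squares are smaller than \<open>p\<close>-th
    powers.\<close>
  then have x2: "summable (\<lambda>i. (x i)\<^sup>2)"
  proof (rule summable_comparison_test_ev[rotated])
    have "\<forall>\<^sub>F i in sequentially. x i powr p < 1"
      using summable_LIMSEQ_zero[OF \<open>summable (\<lambda>i. x i powr p)\<close>] by (rule order_tendstoD) simp
    then show "\<forall>\<^sub>F i in sequentially. norm ((x i)\<^sup>2) \<le> x i powr p"
    proof eventually_elim
      fix i
      assume lt: "x i powr p < 1"
      have pos: "0 < x i"
        by (simp add: x_def)
      have "x i \<le> 1"
      proof (rule ccontr)
        assume "\<not> x i \<le> 1"
        then have "1 \<le> x i powr p"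
          using p by (intro ge_one_powr_ge_zero) auto
        with lt show False
          by simp
      qed
      then have "x i powr 2 \<le> x i powr p"
        using pos p by (intro powr_mono') auto
      then show "norm ((x i)\<^sup>2) \<le> x i powr p"
        using pos by (simp add: powr_numeral)
    qed
  qed
  \<comment> \<open>Since \<open>\<bar>s\<bar>\<close> is at most twice the larger of
    \<open>\<bar>s - v i\<bar>\<close> and \<open>\<bar>v i\<bar>\<close>, this \<open>c\<close>
    gives \<open>1 + \<bar>v i\<bar>\<close> at most \<open>c\<close> times that maximum when
    \<open>s \<noteq> 0\<close>; for \<open>s = 0\<close> the kernel vanishes.\<close>
  define c where "c = 1 + 2 / \<bar>s\<bar>"
  define C where "C = (pi\<^sup>2 / 3) powr A * 2 powr A * (\<bar>s\<bar> * c powr (1 - b))"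
  have c: "1 \<le> c"
    by (simp add: c_def)
  show ?thesis
  proof (rule summable_comparison_test_ev)
    show "summable (\<lambda>i. C\<^sup>2 * (x i)\<^sup>2)"
      using x2 by (rule summable_mult)
    show "\<forall>\<^sub>F i in sequentially. norm (((pi\<^sup>2 * (real (Suc (shell_index (v i))))\<^sup>2 / 3) powr A * g i powr (- A) *
            (\<bar>s - v i\<bar> powr b - \<bar>v i\<bar> powr b))\<^sup>2) \<le> C\<^sup>2 * (x i)\<^sup>2"
      using g
    proof eventually_elim
      fix i
      assume gi: "real (Suc i) / 2 \<le> g i"
      let ?m = "real (Suc (shell_index (v i)))" and ?w = "1 + \<bar>v i\<bar>"
      have "(pi\<^sup>2 * ?m\<^sup>2 / 3) powr A = (pi\<^sup>2 / 3 * ?m\<^sup>2) powr A"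
        by (simp add: field_simps)
      also have "\<dots> = (pi\<^sup>2 / 3) powr A * (?m powr 2) powr A"
        by (subst powr_mult) (simp_all add: powr_numeral)
      also have "\<dots> \<le> (pi\<^sup>2 / 3) powr A * (?w powr 2) powr A"
        using shell_index_bounds[of "v i"] A by (intro mult_left_mono powr_mono2) auto
      finally have 1: "(pi\<^sup>2 * ?m\<^sup>2 / 3) powr A \<le> (pi\<^sup>2 / 3) powr A * ?w powr (2 * A)"
        by (simp only: powr_powr)
      have "g i powr (- A) \<le> (real (Suc i) / 2) powr (- A)"
        using gi A by (intro powr_mono2') auto
      also have "\<dots> = 2 powr A * real (Suc i) powr (- A)"
        by (simp add: powr_divide powr_minus field_simps)
      finally have 2: "g i powr (- A) \<le> 2 powr A * real (Suc i) powr (- A)" .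
      have 3: "\<bar>\<bar>s - v i\<bar> powr b - \<bar>v i\<bar> powr b\<bar> \<le> (\<bar>s\<bar> * c powr (1 - b)) * ?w powr (b - 1)"
      proof (cases "s = 0")
        case False
        let ?M = "max \<bar>s - v i\<bar> \<bar>v i\<bar>"
        have "\<bar>s\<bar> \<le> \<bar>s - v i\<bar> + \<bar>v i\<bar>"
          by linarith
        also have "\<dots> \<le> ?M + ?M"
          by (intro add_mono) simp_all
        finally have "\<bar>s\<bar> \<le> 2 * ?M"
          by simp
        then have "1 \<le> 2 / \<bar>s\<bar> * ?M"
          using False by (simp add: field_simps)
        moreover have "\<bar>v i\<bar> \<le> ?M"
          by (rule max.cobounded2)
        ultimately have "?w \<le> 2 / \<bar>s\<bar> * ?M + ?M"
          by (rule add_mono)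
        then have "?w \<le> c * ?M"
          by (simp add: c_def distrib_right)
        then have "?w / c \<le> ?M"
          using c by (simp add: field_simps)
        then have "?M powr (b - 1) \<le> (?w / c) powr (b - 1)"
          using c A Ab by (intro powr_mono2') auto
        also have "\<dots> = c powr (1 - b) * ?w powr (b - 1)"
          using c by (simp add: powr_divide powr_diff field_simps)
        finally have M: "?M powr (b - 1) \<le> c powr (1 - b) * ?w powr (b - 1)" .
        have "\<bar>\<bar>s - v i\<bar> powr b - \<bar>v i\<bar> powr b\<bar> \<le> \<bar>\<bar>s - v i\<bar> - \<bar>v i\<bar>\<bar> * ?M powr (b - 1)"
          using b A Ab by (intro abs_powr_diff_le) auto
        also have "\<dots> \<le> \<bar>s\<bar> * (c powr (1 - b) * ?w powr (b - 1))"
          using M by (intro mult_mono) auto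
        finally show ?thesis
          by (simp add: mult.assoc)
      qed simp
      have "\<bar>(pi\<^sup>2 * ?m\<^sup>2 / 3) powr A * g i powr (- A) * (\<bar>s - v i\<bar> powr b - \<bar>v i\<bar> powr b)\<bar> =
          (pi\<^sup>2 * ?m\<^sup>2 / 3) powr A * g i powr (- A) * \<bar>\<bar>s - v i\<bar> powr b - \<bar>v i\<bar> powr b\<bar>"
        by (simp add: abs_mult)
      also have "\<dots> \<le> ((pi\<^sup>2 / 3) powr A * ?w powr (2 * A)) * (2 powr A * real (Suc i) powr (- A)) *
          ((\<bar>s\<bar> * c powr (1 - b)) * ?w powr (b - 1))"
        using 1 2 3 by (intro mult_mono) auto
      also have "\<dots> = C * (real (Suc i) powr (- A) * (?w powr (2 * A) * ?w powr (b - 1)))"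
        by (simp add: C_def mult_ac)
      also have "?w powr (2 * A) * ?w powr (b - 1) = ?w powr e"
        by (simp add: e_def powr_add[symmetric] add_diff_eq)
      finally have "\<bar>(pi\<^sup>2 * ?m\<^sup>2 / 3) powr A * g i powr (- A) * (\<bar>s - v i\<bar> powr b - \<bar>v i\<bar> powr b)\<bar> \<le> \<bar>C * x i\<bar>"
        by (simp add: x_def)
      then have "((pi\<^sup>2 * ?m\<^sup>2 / 3) powr A * g i powr (- A) * (\<bar>s - v i\<bar> powr b - \<bar>v i\<bar> powr b))\<^sup>2 \<le> (C * x i)\<^sup>2"
        by (rule abs_le_square_iff[THEN iffD1])
      then show "norm (((pi\<^sup>2 * ?m\<^sup>2 / 3) powr A * g i powr (- A) * (\<bar>s - v i\<bar> powr b - \<bar>v i\<bar> powr b))\<^sup>2) \<le> C\<^sup>2 * (x i)\<^sup>2"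
        by (simp add: power_mult_distrib)
    qed
  qed
qed

section \<open>Lower bound for the increment of a single term\<close>

lemma abs_exp_minus_one_le: "\<bar>x\<bar> \<le> 1 \<Longrightarrow> \<bar>exp x - 1\<bar> \<le> 2 * \<bar>x\<bar>" for x :: real
proof -
  assume x: "\<bar>x\<bar> \<le> 1"
  show ?thesis
  proof (cases "0 \<le> x")
    case True
    then have "exp x \<le> 1 + x + x\<^sup>2"
      using x by (intro exp_bound) auto
    moreover have "x\<^sup>2 \<le> x"
      using True x by (simp add: power2_eq_square mult_left_le)
    ultimately show ?thesis
      using True by simp
  next
    case False
    then have "\<bar>exp x - 1\<bar> = 1 - exp x" "\<bar>x\<bar> = - x"
      by simp_all
    then show ?thesis
      using exp_ge_add_one_self[of x] False by linarith
  qed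
qed

lemma tendsto_powr_mult_abs_ln_at_right_0:
  fixes a c :: real
  assumes a: "0 < a"
  shows "((\<lambda>r. r powr a * (c + \<bar>ln r\<bar>)) \<longlongrightarrow> 0) (at_right 0)"
proof -
  have p: "((\<lambda>r::real. r powr b) \<longlongrightarrow> 0) (at_right 0)" if "0 < b" for b
  proof (rule tendsto_zero_powrI[where b = b])
    show "((\<lambda>r::real. r) \<longlongrightarrow> 0) (at_right 0)"
      by (rule tendsto_ident_at)
    show "\<forall>\<^sub>F r in at_right 0. (0::real) \<le> r"
      using eventually_at_right_less[of 0] by (rule eventually_mono) simp
  qed (use that in simp_all)
  have "((\<lambda>r. \<bar>c\<bar> * r powr a) \<longlongrightarrow> 0) (at_right 0)" "((\<lambda>r. 2 / a * r powr (a / 2)) \<longlongrightarrow> 0) (at_right 0)"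
    by (rule tendsto_mult_right_zero, rule p, use a in simp)+
  from tendsto_add_zero[OF this]
  have lim: "((\<lambda>r. \<bar>c\<bar> * r powr a + 2 / a * r powr (a / 2)) \<longlongrightarrow> 0) (at_right 0)" .
  have "\<forall>\<^sub>F r::real in at_right 0. 0 < r \<and> r < 1"
    unfolding eventually_at_right_field by (intro exI[of _ 1]) auto
  then have "\<forall>\<^sub>F r in at_right 0. norm (r powr a * (c + \<bar>ln r\<bar>)) \<le> \<bar>c\<bar> * r powr a + 2 / a * r powr (a / 2)"
  proof eventually_elim
    fix r :: real
    assume r: "0 < r \<and> r < 1"
    have "\<bar>ln r\<bar> = ln (inverse r)"
      using r by (simp add: ln_inverse)
    also have "\<dots> \<le> inverse r powr (a / 2) / (a / 2)"
      using r a by (intro ln_powr_bound) (auto simp: one_le_inverse)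
    also have "\<dots> = 2 / a * r powr (- (a / 2))"
      using r by (simp add: powr_minus inverse_powr)
    finally have "r powr a * \<bar>ln r\<bar> \<le> r powr a * (2 / a * r powr (- (a / 2)))"
      by (rule mult_left_mono) simp
    also have "\<dots> = 2 / a * r powr (a + - (a / 2))"
      unfolding powr_add by simp
    also have "a + - (a / 2) = a / 2"
      by simp
    finally have 1: "r powr a * \<bar>ln r\<bar> \<le> 2 / a * r powr (a / 2)" .
    have "norm (r powr a * (c + \<bar>ln r\<bar>)) \<le> r powr a * \<bar>c\<bar> + r powr a * \<bar>ln r\<bar>"
      by (simp add: abs_mult distrib_left[symmetric] mult_left_mono)
    then show "norm (r powr a * (c + \<bar>ln r\<bar>)) \<le> \<bar>c\<bar> * r powr a + 2 / a * r powr (a / 2)"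
      using 1 by (simp add: mult.commute)
  qed
  then show ?thesis
    using lim by (rule Lim_null_comparison)
qed

text \<open>The coefficient of one sign in the series, with \<open>g\<close> an arrival time and
  \<open>v\<close> a location. The functions \<open>A\<close> and \<open>b\<close> stand for
  \<open>1 / \<alpha>\<close> and \<open>H - 1 / \<alpha>\<close>; the stable constant is kept
  apart.\<close>

definition kernel :: "(real \<Rightarrow> real) \<Rightarrow> (real \<Rightarrow> real) \<Rightarrow> real \<Rightarrow> real \<Rightarrow> real \<Rightarrow> real" where
  "kernel A b g v s = (pi\<^sup>2 * (real (Suc (shell_index v)))\<^sup>2 / 3) powr A s * g powr (- A s) *
     (\<bar>s - v\<bar> powr b s - \<bar>v\<bar> powr b s)"

lemma lip_at_const_powr:
  assumes "lip_at f t"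
  shows "lip_at (\<lambda>s. c powr f s) t"
proof (cases "c = 0")
  case False
  have "lip_at (\<lambda>s. exp (f s * ln c)) t"
    by (intro lip_at_exp lip_at_mult assms lip_at_const)
  then show ?thesis
    using False by (simp add: powr_def)
qed simp

text \<open>The kernel is singular only at \<open>s = v\<close>, and \<open>v \<noteq> t\<close>
  keeps \<open>\<bar>s - v\<bar>\<close> positive near \<open>t\<close>.\<close>

lemma lip_at_kernel:
  assumes A: "lip_at A t" and b: "lip_at b t" and v: "v \<noteq> t"
  shows "lip_at (kernel A b g v) t"
proof -
  have "lip_at (\<lambda>s. \<bar>s - v\<bar>) t"
    unfolding lip_at_def by (intro exI[of _ 1]) (auto intro!: always_eventually)
  then have "lip_at (\<lambda>s. \<bar>s - v\<bar> powr b s) t"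
    using b v by (intro lip_at_powr) auto
  then show ?thesis
    unfolding kernel_def[abs_def]
    by (intro lip_at_mult lip_at_diff lip_at_const_powr lip_at_minus A b)
qed

text \<open>
  At \<open>s = v\<close> the factor \<open>\<bar>s - v\<bar> powr b s\<close> is \<open>0\<close>, also when \<open>b s = 0\<close>.  The increment is therefore
  \<open>M * \<bar>v - t\<bar> powr b t\<close> up to the increment of a smooth function, which is only of order
  \<open>\<bar>v - t\<bar> * \<bar>ln \<bar>v - t\<bar>\<bar>\<close> relative to \<open>M\<close>.
\<close>

lemma kernel_increment_lower_bound:
  assumes A: "lip_at A t" and b: "lip_at b t" and K: "lip_at K t" and K_pos: "\<And>s. 0 < K s"
    and At: "0 \<le> A t" and bt: "0 \<le> b t" "b t < 1" and \<gamma>: "A t + b t < \<gamma>"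
  shows "\<forall>\<^sub>F v in at t. \<forall>i g. v \<noteq> 0 \<longrightarrow> real (Suc i) / 2 \<le> g \<longrightarrow> g \<le> 2 * real (Suc i) \<longrightarrow>
    \<bar>v - t\<bar> \<le> 1 / real (Suc i) \<longrightarrow>
    \<bar>v - t\<bar> powr \<gamma> \<le> \<bar>K v * kernel A b g v v - K t * kernel A b g v t\<bar>"
proof -
  have lnK: "lip_at (\<lambda>s. ln (K s)) t"
    using K K_pos by (rule lip_at_ln)
  obtain CK where CK: "0 \<le> CK" "\<forall>\<^sub>F s in nhds t. \<bar>ln (K s) - ln (K t)\<bar> \<le> CK * \<bar>s - t\<bar>"
    using lnK by (rule lip_atE)
  obtain CA where CA: "0 \<le> CA" "\<forall>\<^sub>F s in nhds t. \<bar>A s - A t\<bar> \<le> CA * \<bar>s - t\<bar>"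
    using A by (rule lip_atE)
  obtain Cb where Cb: "0 \<le> Cb" "\<forall>\<^sub>F s in nhds t. \<bar>b s - b t\<bar> \<le> Cb * \<bar>s - t\<bar>"
    using b by (rule lip_atE)
  \<comment> \<open>For \<open>r = \<bar>v - t\<bar> < 1\<close>, \<open>T\<close> bounds
    \<open>\<bar>v\<bar>\<close>, while \<open>c1 + \<bar>ln r\<bar>\<close> and
    \<open>c2 + \<bar>ln r\<bar>\<close> will bound the logarithms multiplying \<open>A\<close> and
    \<open>b\<close>. Hence \<open>\<epsilon> r\<close> bounds the change of the logarithm of the
    smooth factor between \<open>t\<close> and \<open>v\<close>.\<close>
  define T where "T = \<bar>t\<bar> + 1"
  define c1 where "c1 = \<bar>ln (pi\<^sup>2 * (\<bar>t\<bar> + 2)\<^sup>2 * 2 / 3)\<bar>"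
  define c2 where "c2 = \<bar>ln (\<bar>t\<bar> / 2)\<bar> + \<bar>ln (\<bar>t\<bar> + 1)\<bar>"
  define D where "D = CK + CA + Cb"
  define c where "c = 1 + c1 + c2"
  define \<epsilon> where "\<epsilon> r = D * (r * (c + \<bar>ln r\<bar>))" for r
  have T: "1 \<le> T" and D: "0 \<le> D" and c12: "0 \<le> c1" "0 \<le> c2"
    using CK CA Cb by (auto simp: T_def D_def c1_def c2_def)
  have lim_\<epsilon>: "(\<epsilon> \<longlongrightarrow> 0) (at_right 0)"
  proof -
    have "((\<lambda>r. D * (r powr 1 * (c + \<bar>ln r\<bar>))) \<longlongrightarrow> 0) (at_right 0)"
      by (intro tendsto_mult_right_zero tendsto_powr_mult_abs_ln_at_right_0) simp
    moreover have "\<forall>\<^sub>F r::real in at_right 0. D * (r powr 1 * (c + \<bar>ln r\<bar>)) = \<epsilon> r"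
      using eventually_at_right_less[of 0] by (rule eventually_mono) (simp add: \<epsilon>_def)
    ultimately show ?thesis
      by (rule Lim_transform_eventually)
  qed
  have ev1: "\<forall>\<^sub>F r in at_right 0. \<epsilon> r < 1"
    using lim_\<epsilon> by (rule order_tendstoD) simp
  \<comment> \<open>After multiplication by \<open>r powr b t\<close> this says that the error
    \<open>2 * T * \<epsilon> r\<close> is less than half of the main term
    \<open>r powr b t\<close>; \<open>b t < 1\<close> leaves a positive power to beat the
    logarithm.\<close>
  have ev2: "\<forall>\<^sub>F r in at_right 0. 2 * T * D * (r powr (1 - b t) * (c + \<bar>ln r\<bar>)) < 1 / 2"
  proof (rule order_tendstoD)
    show "((\<lambda>r. 2 * T * D * (r powr (1 - b t) * (c + \<bar>ln r\<bar>))) \<longlongrightarrow> 0) (at_right 0)"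
      using bt by (intro tendsto_mult_right_zero tendsto_powr_mult_abs_ln_at_right_0) simp
  qed simp
  \<comment> \<open>The gap \<open>\<gamma> - A t - b t > 0\<close> absorbs the constant
    \<open>K t / 2\<close>. The factor \<open>1 + \<bar>ln r\<bar> \<ge> 1\<close> is there so that
    the same limit can be used.\<close>
  have ev3: "\<forall>\<^sub>F r in at_right 0. r powr (\<gamma> - A t - b t) * (1 + \<bar>ln r\<bar>) < K t / 2"
    by (rule order_tendstoD, rule tendsto_powr_mult_abs_ln_at_right_0) (use \<gamma> K_pos in simp_all)
  define good where "good r \<longleftrightarrow> r < 1 \<and> \<epsilon> r < 1 \<and> 2 * T * D * (r powr (1 - b t) * (c + \<bar>ln r\<bar>)) < 1 / 2 \<and>
    r powr (\<gamma> - A t - b t) * (1 + \<bar>ln r\<bar>) < K t / 2" for r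
  have "\<forall>\<^sub>F r::real in at_right 0. r < 1"
    unfolding eventually_at_right_field by (intro exI[of _ 1]) auto
  then have "\<forall>\<^sub>F r in at_right 0. good r"
    using ev1 ev2 ev3 unfolding good_def by eventually_elim simp
  then obtain \<delta> where \<delta>: "0 < \<delta>" "\<And>r. 0 < r \<Longrightarrow> r < \<delta> \<Longrightarrow> good r"
    unfolding eventually_at_right_field by blast
  have ev_dist: "\<forall>\<^sub>F v in nhds t. \<bar>v - t\<bar> < \<delta>"
    using \<delta>(1) by (auto simp: eventually_nhds_metric dist_real_def)
  have ev_t: "\<forall>\<^sub>F v in nhds t. t \<noteq> 0 \<longrightarrow> \<bar>v - t\<bar> < \<bar>t\<bar> / 2"
  proof (cases "t = 0")
    case False
    then have "0 < \<bar>t\<bar> / 2"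
      by simp
    then have "\<forall>\<^sub>F v in nhds t. \<bar>v - t\<bar> < \<bar>t\<bar> / 2"
      unfolding eventually_nhds_metric dist_real_def by blast
    then show ?thesis
      by (rule eventually_mono) simp
  qed simp
  show ?thesis
    unfolding eventually_at_filter
    using CK(2) CA(2) Cb(2) ev_dist ev_t
  proof eventually_elim
    fix v
    assume eK: "\<bar>ln (K v) - ln (K t)\<bar> \<le> CK * \<bar>v - t\<bar>" and eA: "\<bar>A v - A t\<bar> \<le> CA * \<bar>v - t\<bar>"
      and eb: "\<bar>b v - b t\<bar> \<le> Cb * \<bar>v - t\<bar>" and v\<delta>: "\<bar>v - t\<bar> < \<delta>" and vt: "t \<noteq> 0 \<longrightarrow> \<bar>v - t\<bar> < \<bar>t\<bar> / 2"
    show "v \<noteq> t \<longrightarrow> v \<in> UNIV \<longrightarrow> (\<forall>i g. v \<noteq> 0 \<longrightarrow> real (Suc i) / 2 \<le> g \<longrightarrow> g \<le> 2 * real (Suc i) \<longrightarrow>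
      \<bar>v - t\<bar> \<le> 1 / real (Suc i) \<longrightarrow>
      \<bar>v - t\<bar> powr \<gamma> \<le> \<bar>K v * kernel A b g v v - K t * kernel A b g v t\<bar>)"
    proof (intro impI allI)
      fix i g
      assume "v \<noteq> t" and v0: "v \<noteq> 0" and g: "real (Suc i) / 2 \<le> g" "g \<le> 2 * real (Suc i)"
        and ri: "\<bar>v - t\<bar> \<le> 1 / real (Suc i)"
      define r where "r = \<bar>v - t\<bar>"
      define m where "m = real (Suc (shell_index v))"
      define L where "L = ln (pi\<^sup>2 * m\<^sup>2 / 3 / g)"
      define l where "l = ln \<bar>v\<bar>"
      \<comment> \<open>The smooth factor written as one exponential, so that
        \<open>F v / F t = exp E\<close> with \<open>E\<close> linear in the increments of
        \<open>ln K\<close>, \<open>A\<close> and \<open>b\<close>. \<open>M\<close> is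
        \<open>F t\<close> without its factor \<open>\<bar>v\<bar> powr b t\<close>.\<close>
      define F where "F s = exp (ln (K s) + A s * L + b s * l)" for s
      define M where "M = exp (ln (K t) + A t * L)"
      have r: "0 < r"
        using \<open>v \<noteq> t\<close> by (simp add: r_def)
      have good: "good r"
        using \<delta>(2)[OF r] v\<delta> by (simp add: r_def)
      then have r1: "r < 1"
        by (simp add: good_def)
      have gpos: "0 < g"
        using g by (simp add: field_simps)
      have m: "1 \<le> m" "m \<le> \<bar>t\<bar> + 2"
        using shell_index_bounds[of v] r1 by (auto simp: m_def r_def)
      have lnr: "\<bar>ln r\<bar> = - ln r"
        using r r1 by simp
      have lpi: "0 < pi\<^sup>2 * m\<^sup>2 / 3 / g"
        using m gpos by simp
      have L_le: "L \<le> c1"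
      proof -
        have "1 / 2 \<le> g"
          using g(1) by (simp add: field_simps)
        then have "pi\<^sup>2 * m\<^sup>2 / 3 / g \<le> pi\<^sup>2 * (\<bar>t\<bar> + 2)\<^sup>2 / 3 / (1 / 2)"
          using m by (intro frac_le divide_right_mono mult_left_mono power_mono) auto
        also have "\<dots> = pi\<^sup>2 * (\<bar>t\<bar> + 2)\<^sup>2 * 2 / 3"
          by simp
        finally have "L \<le> ln (pi\<^sup>2 * (\<bar>t\<bar> + 2)\<^sup>2 * 2 / 3)"
          unfolding L_def using lpi by (intro ln_mono) auto
        then show ?thesis
          by (simp add: c1_def)
      qed
      \<comment> \<open>Here closeness to \<open>t\<close> meets the arrival time:
        \<open>r \<le> 1 / real (Suc i)\<close> and \<open>g \<le> 2 * real (Suc i)\<close> give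
        \<open>r * g \<le> 2\<close>. The resulting \<open>ln r \<le> L\<close> yields
        \<open>K t * r powr A t \<le> M\<close>.\<close>
      have L_ge: "ln r \<le> L"
      proof -
        have "3\<^sup>2 \<le> pi\<^sup>2"
          using pi_gt3 by (intro power_mono) auto
        moreover have "1 \<le> m\<^sup>2"
          using m(1) by simp
        ultimately have "9 * 1 \<le> pi\<^sup>2 * m\<^sup>2"
          by (intro mult_mono) auto
        moreover have "r * g \<le> 2"
        proof -
          have "r * g \<le> 1 / real (Suc i) * (2 * real (Suc i))"
            using ri g r gpos by (intro mult_mono) (auto simp: r_def)
          also have "\<dots> = 2"
            by (simp del: of_nat_Suc)
          finally show ?thesis .
        qed
        ultimately have "r * g \<le> pi\<^sup>2 * m\<^sup>2 / 3"
          by simp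
        then have "r \<le> pi\<^sup>2 * m\<^sup>2 / 3 / g"
          using gpos by (simp add: field_simps)
        then show ?thesis
          unfolding L_def using r by (intro ln_mono) auto
      qed
      have L: "\<bar>L\<bar> \<le> c1 + \<bar>ln r\<bar>"
        using L_le L_ge c12 lnr by linarith
      have l: "\<bar>l\<bar> \<le> c2 + \<bar>ln r\<bar>"
      proof (cases "t = 0")
        case True
        then show ?thesis
          using c12 by (simp add: l_def r_def)
      next
        case False
        then have "r < \<bar>t\<bar> / 2"
          using vt by (simp add: r_def)
        then have v: "\<bar>t\<bar> / 2 \<le> \<bar>v\<bar>" "\<bar>v\<bar> \<le> \<bar>t\<bar> + 1"
          using r1 unfolding r_def by linarith+
        then have "ln (\<bar>t\<bar> / 2) \<le> l" "l \<le> ln (\<bar>t\<bar> + 1)"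
          unfolding l_def using False v0 by (auto intro!: ln_mono)
        then show ?thesis
          unfolding c2_def by linarith
      qed
      have exp_L: "exp (a * L) = (pi\<^sup>2 * m\<^sup>2 / 3) powr a * g powr (- a)" for a
      proof -
        define P where "P = pi\<^sup>2 * m\<^sup>2 / 3"
        have "0 < P"
          using m by (simp add: P_def)
        then have "exp (a * ln (P / g)) = P powr a * g powr (- a)"
          using gpos by (simp add: ln_div powr_def right_diff_distrib exp_diff exp_minus field_simps)
        then show ?thesis
          by (simp add: L_def P_def)
      qed
      have F: "F v = K v * (pi\<^sup>2 * m\<^sup>2 / 3) powr A v * g powr (- A v) * \<bar>v\<bar> powr b v"
        and Ft: "F t = K t * (pi\<^sup>2 * m\<^sup>2 / 3) powr A t * g powr (- A t) * \<bar>v\<bar> powr b t"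
        and M: "M = K t * (pi\<^sup>2 * m\<^sup>2 / 3) powr A t * g powr (- A t)"
        using K_pos[of v] K_pos[of t] v0
        by (simp_all add: F_def M_def exp_add exp_L l_def powr_def[of "\<bar>v\<bar>"] mult.assoc)
      have inc: "K v * kernel A b g v v - K t * kernel A b g v t = F t - F v - M * r powr b t"
        unfolding kernel_def m_def[symmetric] F Ft M r_def by (simp add: algebra_simps abs_minus_commute)
      define E where "E = (ln (K v) - ln (K t)) + (A v - A t) * L + (b v - b t) * l"
      have E: "\<bar>E\<bar> \<le> \<epsilon> r"
      proof -
        have "\<bar>E\<bar> \<le> \<bar>ln (K v) - ln (K t)\<bar> + \<bar>A v - A t\<bar> * \<bar>L\<bar> + \<bar>b v - b t\<bar> * \<bar>l\<bar>"
          unfolding E_def abs_mult[symmetric] by linarith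
        also have "\<dots> \<le> CK * r * (c + \<bar>ln r\<bar>) + CA * r * (c + \<bar>ln r\<bar>) + Cb * r * (c + \<bar>ln r\<bar>)"
        proof (intro add_mono)
          have "CK * r * 1 \<le> CK * r * (c + \<bar>ln r\<bar>)"
            using CK r c12 by (intro mult_left_mono) (auto simp: c_def)
          then show "\<bar>ln (K v) - ln (K t)\<bar> \<le> CK * r * (c + \<bar>ln r\<bar>)"
            using eK by (simp add: r_def)
          show "\<bar>A v - A t\<bar> * \<bar>L\<bar> \<le> CA * r * (c + \<bar>ln r\<bar>)"
            using eA L CA r c12 by (intro mult_mono) (auto simp: r_def c_def)
          show "\<bar>b v - b t\<bar> * \<bar>l\<bar> \<le> Cb * r * (c + \<bar>ln r\<bar>)"
            using eb l Cb r c12 by (intro mult_mono) (auto simp: r_def c_def)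
        qed
        also have "\<dots> = \<epsilon> r"
          by (simp add: \<epsilon>_def D_def algebra_simps)
        finally show ?thesis .
      qed
      have "F v = F t * exp E"
        unfolding F_def E_def exp_add[symmetric] by (simp add: algebra_simps)
      then have "F v - F t = F t * (exp E - 1)"
        by (simp add: right_diff_distrib)
      then have "\<bar>F v - F t\<bar> = F t * \<bar>exp E - 1\<bar>"
        by (simp add: abs_mult F_def)
      also have "\<dots> \<le> F t * (2 * \<epsilon> r)"
      proof (rule mult_left_mono)
        have "\<bar>E\<bar> \<le> 1"
          using E good by (simp add: good_def)
        then show "\<bar>exp E - 1\<bar> \<le> 2 * \<epsilon> r"
          using abs_exp_minus_one_le[of E] E by linarith
      qed (simp add: F_def)
      also have "\<dots> \<le> (M * T) * (2 * \<epsilon> r)"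
      proof (rule mult_right_mono)
        have "\<bar>v\<bar> \<le> T"
          using r1 by (simp add: T_def r_def)
        then have "\<bar>v\<bar> powr b t \<le> T powr 1"
          using bt T by (intro order_trans[OF powr_mono2[of "b t" "\<bar>v\<bar>" T] powr_mono]) auto
        moreover have "0 \<le> M"
          by (simp add: M_def)
        ultimately show "F t \<le> M * T"
          unfolding Ft M using T by (intro mult_left_mono) (auto simp: M)
        show "0 \<le> 2 * \<epsilon> r"
          using E by linarith
      qed
      also have "\<dots> \<le> M * (r powr b t / 2)"
      proof -
        have "r * (c + \<bar>ln r\<bar>) = r powr b t * (r powr (1 - b t) * (c + \<bar>ln r\<bar>))"
          using r by (simp add: powr_diff)
        then have "2 * T * \<epsilon> r = r powr b t * (2 * T * D * (r powr (1 - b t) * (c + \<bar>ln r\<bar>)))"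
          by (simp add: \<epsilon>_def)
        also have "\<dots> \<le> r powr b t * (1 / 2)"
          using good by (intro mult_left_mono) (auto simp: good_def)
        finally have "M * (2 * T * \<epsilon> r) \<le> M * (r powr b t / 2)"
          by (intro mult_left_mono) (auto simp: M_def)
        then show ?thesis
          by (simp add: mult_ac)
      qed
      finally have "\<bar>F v - F t\<bar> \<le> M * (r powr b t / 2)" .
      moreover have "M * r powr b t - \<bar>F v - F t\<bar> \<le> \<bar>F t - F v - M * r powr b t\<bar>"
        by linarith
      moreover have "M * (r powr b t / 2) + M * (r powr b t / 2) = M * r powr b t"
        by simp
      ultimately have "M * (r powr b t / 2) \<le> \<bar>F t - F v - M * r powr b t\<bar>"
        by linarith
      moreover have "r powr \<gamma> \<le> M * (r powr b t / 2)"
      proof -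
        have "r powr (\<gamma> - A t - b t) * 1 \<le> r powr (\<gamma> - A t - b t) * (1 + \<bar>ln r\<bar>)"
          by (intro mult_left_mono) auto
        then have "r powr (\<gamma> - A t - b t) \<le> K t / 2"
          using good by (simp add: good_def)
        then have "r powr (\<gamma> - A t - b t) * (r powr A t * r powr b t) \<le> K t / 2 * (r powr A t * r powr b t)"
          by (rule mult_right_mono) simp
        moreover have "r powr (\<gamma> - A t - b t) * (r powr A t * r powr b t) = r powr \<gamma>"
          by (simp add: powr_add[symmetric])
        moreover have "K t * r powr A t \<le> M"
        proof -
          have "K t * r powr A t = exp (ln (K t) + A t * ln r)"
            using K_pos[of t] r by (simp add: exp_add powr_def)
          also have "\<dots> \<le> M"
            unfolding M_def using L_ge At by (simp add: mult_left_mono)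
          finally show ?thesis .
        qed
        then have "K t * r powr A t * (r powr b t / 2) \<le> M * (r powr b t / 2)"
          by (rule mult_right_mono) simp
        ultimately show ?thesis
          by simp
      qed
      ultimately show "\<bar>v - t\<bar> powr \<gamma> \<le> \<bar>K v * kernel A b g v v - K t * kernel A b g v t\<bar>"
        unfolding inc r_def by linarith
    qed
  qed
qed

section \<open>Irregularity of the paths\<close>

lemma summable_square_diff:
  fixes x y :: "nat \<Rightarrow> real"
  assumes "summable (\<lambda>i. (x i)\<^sup>2)" "summable (\<lambda>i. (y i)\<^sup>2)"
  shows "summable (\<lambda>i. (x i - y i)\<^sup>2)"
proof (rule summable_comparison_test'[of "\<lambda>i. 2 * (x i)\<^sup>2 + 2 * (y i)\<^sup>2" 0])
  show "summable (\<lambda>i. 2 * (x i)\<^sup>2 + 2 * (y i)\<^sup>2)"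
    by (intro summable_add summable_mult assms)
  show "norm ((x i - y i)\<^sup>2) \<le> 2 * (x i)\<^sup>2 + 2 * (y i)\<^sup>2" for i
  proof -
    have "norm ((x i - y i)\<^sup>2) = (x i - y i)\<^sup>2"
      by simp
    also have "\<dots> = (x i)\<^sup>2 + (y i)\<^sup>2 - 2 * x i * y i"
      by (rule power2_diff)
    finally show ?thesis
      using zero_le_power2[of "x i + y i"] unfolding power2_sum by linarith
  qed
qed

text \<open>Everything except the signs is frozen: \<open>g\<close> and \<open>v\<close> are one
  realization of arrival times and locations. The sequence is padded with 0 at indices where
  \<open>v i\<close> is not close to \<open>t\<close>, which avoids extracting a
  subsequence.\<close>

lemma AE_coins_kernel_series_not_little_o:
  fixes A b K :: "real \<Rightarrow> real" and g v :: "nat \<Rightarrow> real"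
  assumes A: "lip_at A t" and b: "lip_at b t" and K: "lip_at K t" and K_pos: "\<And>s. 0 < K s"
    and Ab: "\<And>s. 1 / 2 < A s" "\<And>s. 0 \<le> b s" "\<And>s. A s + b s < 1"
    and g: "\<forall>\<^sub>F i in sequentially. real (Suc i) / 2 \<le> g i \<and> g i \<le> 2 * real (Suc i)"
    and v_neq: "\<And>i. v i \<noteq> 0" "\<And>i. v i \<noteq> t"
    and v_sum: "\<And>n. summable (\<lambda>i. real (Suc i) powr (- (1 + 1 / real (Suc n))) * (1 + \<bar>v i\<bar>) powr (1 - 1 / real (Suc n)))"
    and near: "\<exists>\<^sub>\<infinity>i. \<bar>v i - t\<bar> \<le> 1 / real (Suc i)"
    and \<gamma>: "A t + b t < \<gamma>" "\<gamma> < 1"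
  defines "Y \<equiv> \<lambda>\<omega> s. K s * (\<Sum>k. \<omega> k * kernel A b (g k) (v k) s)"
  shows "AE \<omega> in coins. \<not> (\<lambda>i. if \<bar>v i - t\<bar> \<le> 1 / real (Suc i)
    then \<bar>Y \<omega> (v i) - Y \<omega> t\<bar> / \<bar>v i - t\<bar> powr \<gamma> else 0) \<longlonglongrightarrow> 0"
proof -
  define c where "c k s = K s * kernel A b (g k) (v k) s" for k s
  have sq_kernel: "summable (\<lambda>k. (kernel A b (g k) (v k) s)\<^sup>2)" for s
    unfolding kernel_def using Ab v_sum g by (intro square_summable_scaled_kernel) (auto elim: eventually_mono)
  have sq_c: "summable (\<lambda>k. (c k s)\<^sup>2)" for s
    unfolding c_def power_mult_distrib using sq_kernel by (rule summable_mult)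
  have lip_c: "lip_at (c k) t" for k
    unfolding c_def[abs_def] by (intro lip_at_mult K lip_at_kernel A b v_neq)
  define I where "I i \<longleftrightarrow> \<bar>v i - t\<bar> \<le> 1 / real (Suc i)" for i
  define x where "x i k = (if I i then (c k (v i) - c k t) / \<bar>v i - t\<bar> powr \<gamma> else 0)" for i k
  \<comment> \<open>Padding with \<open>t\<close> itself produces a sequence converging to
    \<open>t\<close> and indexed by all natural numbers.\<close>
  define y where "y i = (if I i then v i else t)" for i
  have y: "y \<longlonglongrightarrow> t"
  proof (rule LIM_zero_cancel, rule Lim_null_comparison)
    show "\<forall>\<^sub>F i in sequentially. norm (y i - t) \<le> 1 / real (Suc i)"
      by (rule always_eventually) (simp add: y_def I_def)
    show "(\<lambda>i. 1 / real (Suc i)) \<longlonglongrightarrow> 0"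
      using LIMSEQ_inverse_real_of_nat by (simp add: inverse_eq_divide)
  qed
  have "AE \<omega> in coins. \<not> (\<lambda>i. \<Sum>k. \<omega> k * x i k) \<longlonglongrightarrow> 0"
  proof (rule AE_coins_array_not_null)
    show "summable (\<lambda>k. (x i k)\<^sup>2)" for i
    proof (cases "I i")
      case True
      have "summable (\<lambda>k. (c k (v i) - c k t)\<^sup>2 / (\<bar>v i - t\<bar> powr \<gamma>)\<^sup>2)"
        by (intro summable_divide summable_square_diff sq_c)
      then show ?thesis
        using True by (simp add: x_def power_divide)
    qed (simp add: x_def)
    show "(\<lambda>i. x i k) \<longlonglongrightarrow> 0" for k
    proof -
      \<comment> \<open>At \<open>s = t\<close> this quotient is \<open>0 / 0 = 0\<close>, so its
        limit at \<open>t\<close> says that it is continuous there, and the padded indices get the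
        right value.\<close>
      let ?q = "\<lambda>s. (c k s - c k t) / \<bar>s - t\<bar> powr \<gamma>"
      have "(?q \<longlongrightarrow> ?q t) (at t)"
        using lip_at_little_o[OF lip_c \<gamma>(2)] by simp
      then have "isCont ?q t"
        by (simp add: isCont_def)
      then have "(\<lambda>i. ?q (y i)) \<longlonglongrightarrow> ?q t"
        using y by (rule isCont_tendsto_compose)
      moreover have "?q (y i) = x i k" for i
        by (simp add: x_def y_def)
      ultimately show ?thesis
        by simp
    qed
    have "\<forall>\<^sub>F w in at t. \<forall>i g. w \<noteq> 0 \<longrightarrow> real (Suc i) / 2 \<le> g \<longrightarrow> g \<le> 2 * real (Suc i) \<longrightarrow>
      \<bar>w - t\<bar> \<le> 1 / real (Suc i) \<longrightarrow>
      \<bar>w - t\<bar> powr \<gamma> \<le> \<bar>K w * kernel A b g w w - K t * kernel A b g w t\<bar>"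
      using Ab(1)[of t] Ab(2)[of t] Ab(3)[of t] \<gamma> by (intro kernel_increment_lower_bound A b K K_pos) auto
    then have "\<forall>\<^sub>F i in sequentially. y i \<noteq> t \<longrightarrow> (\<forall>j g. y i \<noteq> 0 \<longrightarrow> real (Suc j) / 2 \<le> g \<longrightarrow> g \<le> 2 * real (Suc j) \<longrightarrow>
      \<bar>y i - t\<bar> \<le> 1 / real (Suc j) \<longrightarrow>
      \<bar>y i - t\<bar> powr \<gamma> \<le> \<bar>K (y i) * kernel A b g (y i) (y i) - K t * kernel A b g (y i) t\<bar>)"
      unfolding eventually_at_filter using y by (auto elim!: eventually_compose_filterlim[THEN eventually_mono])
    \<comment> \<open>The large entry is the diagonal one: in row \<open>i\<close> the increment is
      taken to the location of the \<open>i\<close>-th term.\<close>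
    then have "\<forall>\<^sub>F i in sequentially. I i \<longrightarrow> 1 \<le> \<bar>x i i\<bar>"
      using g
    proof eventually_elim
      fix i
      assume *: "y i \<noteq> t \<longrightarrow> (\<forall>j g. y i \<noteq> 0 \<longrightarrow> real (Suc j) / 2 \<le> g \<longrightarrow> g \<le> 2 * real (Suc j) \<longrightarrow>
          \<bar>y i - t\<bar> \<le> 1 / real (Suc j) \<longrightarrow>
          \<bar>y i - t\<bar> powr \<gamma> \<le> \<bar>K (y i) * kernel A b g (y i) (y i) - K t * kernel A b g (y i) t\<bar>)"
        and gi: "real (Suc i) / 2 \<le> g i \<and> g i \<le> 2 * real (Suc i)"
      show "I i \<longrightarrow> 1 \<le> \<bar>x i i\<bar>"
      proof
        assume "I i"
        then have "y i = v i" "\<bar>v i - t\<bar> \<le> 1 / real (Suc i)"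
          by (simp_all add: y_def I_def)
        then have "\<bar>v i - t\<bar> powr \<gamma> \<le> \<bar>c i (v i) - c i t\<bar>"
          using *[unfolded \<open>y i = v i\<close>, rule_format, of i "g i"] v_neq gi unfolding c_def by blast
        then show "1 \<le> \<bar>x i i\<bar>"
          using v_neq(2)[of i] \<open>I i\<close> by (simp add: x_def abs_divide)
      qed
    qed
    then have "\<forall>\<^sub>F i in sequentially. I i \<longrightarrow> (\<exists>k. 1 \<le> \<bar>x i k\<bar>)"
      by (rule eventually_mono) blast
    moreover have "\<exists>\<^sub>F i in sequentially. I i"
      using near unfolding cofinite_eq_sequentially I_def .
    ultimately show "\<exists>\<^sub>\<infinity>i. \<exists>k. 1 \<le> \<bar>x i k\<bar>"
      unfolding cofinite_eq_sequentially by (rule frequently_rev_mp[rotated])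
  qed
  moreover have "AE \<omega> in coins. \<forall>i. summable (\<lambda>k. \<omega> k * kernel A b (g k) (v k) (v i))"
    unfolding AE_all_countable using AE_coins_summable[OF sq_kernel] by blast
  moreover have "AE \<omega> in coins. summable (\<lambda>k. \<omega> k * kernel A b (g k) (v k) t)"
    by (rule AE_coins_summable[OF sq_kernel])
  ultimately show ?thesis
  proof eventually_elim
    fix \<omega> :: "nat \<Rightarrow> real"
    assume lim: "\<not> (\<lambda>i. \<Sum>k. \<omega> k * x i k) \<longlonglongrightarrow> 0"
      and sv: "\<forall>i. summable (\<lambda>k. \<omega> k * kernel A b (g k) (v k) (v i))"
      and st: "summable (\<lambda>k. \<omega> k * kernel A b (g k) (v k) t)"
    have "\<bar>\<Sum>k. \<omega> k * x i k\<bar> = (if \<bar>v i - t\<bar> \<le> 1 / real (Suc i)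
      then \<bar>Y \<omega> (v i) - Y \<omega> t\<bar> / \<bar>v i - t\<bar> powr \<gamma> else 0)" for i
    proof (cases "I i")
      case True
      have "(\<lambda>k. (K (v i) * (\<omega> k * kernel A b (g k) (v k) (v i)) - K t * (\<omega> k * kernel A b (g k) (v k) t)) / \<bar>v i - t\<bar> powr \<gamma>)
        sums ((Y \<omega> (v i) - Y \<omega> t) / \<bar>v i - t\<bar> powr \<gamma>)"
        unfolding Y_def by (intro sums_divide sums_diff sums_mult summable_sums st sv[rule_format])
      moreover have "(\<lambda>k. (K (v i) * (\<omega> k * kernel A b (g k) (v k) (v i)) - K t * (\<omega> k * kernel A b (g k) (v k) t)) / \<bar>v i - t\<bar> powr \<gamma>)
        = (\<lambda>k. \<omega> k * x i k)"
        using True by (simp add: x_def c_def fun_eq_iff algebra_simps)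
      ultimately have "(\<Sum>k. \<omega> k * x i k) = (Y \<omega> (v i) - Y \<omega> t) / \<bar>v i - t\<bar> powr \<gamma>"
        by (simp add: sums_iff)
      then show ?thesis
        using True by (simp add: I_def abs_divide)
    next
      case False
      then show ?thesis
        unfolding x_def I_def by simp
    qed
    then show "\<not> (\<lambda>i. if \<bar>v i - t\<bar> \<le> 1 / real (Suc i)
      then \<bar>Y \<omega> (v i) - Y \<omega> t\<bar> / \<bar>v i - t\<bar> powr \<gamma> else 0) \<longlonglongrightarrow> 0"
      using lim tendsto_rabs_zero_iff[of "\<lambda>i. \<Sum>k. \<omega> k * x i k" sequentially] by simp
  qed
qed

section \<open>From the coin space to the given probability space\<close>

lemma (in prob_space) distr_coins:
  assumes indep: "indep_vars (\<lambda>_. borel) \<gamma> UNIV"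
    and p: "\<And>i::nat. prob {\<omega> \<in> space M. \<gamma> i \<omega> = 1} = 1 / 2 \<and> prob {\<omega> \<in> space M. \<gamma> i \<omega> = - 1} = 1 / 2"
  shows "distr M (\<Pi>\<^sub>M i\<in>UNIV. borel) (\<lambda>\<omega> i. \<gamma> i \<omega>) = coins"
proof -
  have rv [measurable]: "random_variable borel (\<gamma> i)" for i
    using indep by (simp add: indep_vars_def2)
  have "distr M borel (\<gamma> i) = coin" for i
  proof (rule measure_eqI)
    fix B assume "B \<in> sets (distr M borel (\<gamma> i))"
    then have [measurable]: "B \<in> sets borel"
      by simp
    let ?E = "\<lambda>x. {\<omega> \<in> space M. \<gamma> i \<omega> = x}"
    have "prob (?E 1 \<union> ?E (- 1)) = 1"
      using p[of i] by (subst finite_measure_Union) auto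
    then have "AE \<omega> in M. \<omega> \<in> ?E 1 \<union> ?E (- 1)"
      by (subst (asm) prob_eq_1) auto
    then have ae: "AE \<omega> in M. \<gamma> i \<omega> = 1 \<or> \<gamma> i \<omega> = - 1"
      by eventually_elim auto
    have "emeasure (distr M borel (\<gamma> i)) B = emeasure M {\<omega> \<in> space M. \<gamma> i \<omega> \<in> B}"
      by (subst emeasure_distr) (auto simp: vimage_def Int_def conj_commute)
    also have "\<dots> = (\<integral>\<^sup>+\<omega>. indicator {\<omega> \<in> space M. \<gamma> i \<omega> \<in> B} \<omega> \<partial>M)"
      by simp
    also have "\<dots> = (\<integral>\<^sup>+\<omega>. indicator B 1 * indicator (?E 1) \<omega> + indicator B (- 1) * indicator (?E (- 1)) \<omega> \<partial>M)"
    proof (rule nn_integral_cong_AE)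
      show "AE \<omega> in M. (indicator {\<omega> \<in> space M. \<gamma> i \<omega> \<in> B} \<omega> :: ennreal) =
          indicator B 1 * indicator (?E 1) \<omega> + indicator B (- 1) * indicator (?E (- 1)) \<omega>"
        using ae AE_space by eventually_elim (auto simp: indicator_def)
    qed
    also have "\<dots> = indicator B 1 * emeasure M (?E 1) + indicator B (- 1) * emeasure M (?E (- 1))"
      by (simp add: nn_integral_add nn_integral_cmult_indicator)
    also have "\<dots> = emeasure coin B"
    proof -
      have "ennreal (1 / 2) = inverse 2"
        by (simp add: divide_ennreal[symmetric] divide_ennreal_def)
      then have "emeasure M (?E 1) = inverse 2" "emeasure M (?E (- 1)) = inverse 2"
        using p[of i] by (simp_all only: emeasure_eq_measure)
      then show ?thesis
        by (simp add: emeasure_coin divide_ennreal_def distrib_right)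
    qed
    finally show "emeasure (distr M borel (\<gamma> i)) B = emeasure coin B" .
  qed simp
  then show ?thesis
    using indep by (subst (asm) indep_vars_iff_distr_eq_PiM) (simp_all add: restrict_UNIV)
qed

lemma borel_measurable_shell_index [measurable]: "(\<lambda>x. real (Suc (shell_index x))) \<in> borel_measurable borel"
proof -
  have "(\<lambda>x. \<Sum>j. real (Suc j) * indicator (unit_shell (Suc j)) x) \<in> borel_measurable borel"
    by measurable
  then show ?thesis
    by (simp add: suminf_shell del: of_nat_Suc)
qed

lemma borel_measurable_kernel [measurable (raw)]:
  assumes [measurable]: "A \<in> borel_measurable borel" "b \<in> borel_measurable borel"
    and [measurable]: "g \<in> borel_measurable M" "v \<in> borel_measurable M" "s \<in> borel_measurable M"
  shows "(\<lambda>x. kernel A b (g x) (v x) (s x)) \<in> borel_measurable M"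
  unfolding kernel_def by measurable

lemma lmmm_eq_kernel_series:
  "lmmm \<alpha> H \<Gamma> V \<gamma> s \<omega> = stable_const (\<alpha> s) powr (1 / \<alpha> s) *
    (\<Sum>k. \<gamma> k \<omega> * kernel (\<lambda>u. 1 / \<alpha> u) (\<lambda>u. H u - 1 / \<alpha> u) (\<Gamma> k \<omega>) (V k \<omega>) s)"
  unfolding lmmm_def lmmm_field_def suminf_shell kernel_def by (simp add: mult_ac del: of_nat_Suc)

text \<open>An admissible exponent \<open>\<gamma> > h\<close> makes every smaller exponent
  admissible, because \<open>\<bar>r\<bar> powr (\<gamma> - q)\<close> tends to 0. So it suffices to
  refute rational exponents between \<open>h\<close> and 1: countably many, each with its own null
  set, and all in the range where Lipschitz coefficients are negligible.\<close>

lemma pointwise_holder_exponent_leI: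
  assumes h: "h < 1"
    and nlim: "\<And>q. h < real_of_rat q \<Longrightarrow> real_of_rat q < 1 \<Longrightarrow>
      \<not> (\<lambda>i. if \<bar>v i - t\<bar> \<le> 1 / real (Suc i) then \<bar>f (v i) - f t\<bar> / \<bar>v i - t\<bar> powr real_of_rat q else 0) \<longlonglongrightarrow> 0"
  shows "pointwise_holder_exponent f t \<le> ereal h"
  unfolding pointwise_holder_exponent_def
proof (rule SUP_least, rule ccontr)
  fix \<gamma>
  assume "\<gamma> \<in> {\<gamma>. ((\<lambda>r. \<bar>f (t + r) - f t\<bar> / \<bar>r\<bar> powr \<gamma>) \<longlongrightarrow> 0) (at 0)}" and "\<not> ereal \<gamma> \<le> ereal h"
  then have lim: "((\<lambda>r. \<bar>f (t + r) - f t\<bar> / \<bar>r\<bar> powr \<gamma>) \<longlongrightarrow> 0) (at 0)" and "h < min \<gamma> 1"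
    using h by auto
  then obtain q where q: "h < real_of_rat q" "real_of_rat q < min \<gamma> 1"
    using of_rat_dense by blast
  let ?p = "real_of_rat q"
  \<comment> \<open>At \<open>r = 0\<close> the quotient \<open>?g\<close> equals
    \<open>0 / 0 = 0\<close>, which matches the padding by 0 in the hypothesis.\<close>
  define r where "r i = (if \<bar>v i - t\<bar> \<le> 1 / real (Suc i) then v i - t else 0)" for i
  have r: "r \<longlonglongrightarrow> 0"
  proof (rule Lim_null_comparison)
    show "\<forall>\<^sub>F i in sequentially. norm (r i) \<le> 1 / real (Suc i)"
      by (rule always_eventually) (simp add: r_def)
    show "(\<lambda>i. 1 / real (Suc i)) \<longlonglongrightarrow> 0"
      using LIMSEQ_inverse_real_of_nat by (simp add: inverse_eq_divide)
  qed
  let ?g = "\<lambda>r. \<bar>f (t + r) - f t\<bar> / \<bar>r\<bar> powr ?p"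
  have "(?g \<longlongrightarrow> 0) (at 0)"
  proof -
    have "((\<lambda>r::real. \<bar>r\<bar>) \<longlongrightarrow> 0) (at 0)"
      by (rule tendsto_rabs_zero) (rule tendsto_ident_at)
    then have "((\<lambda>r::real. \<bar>r\<bar> powr (\<gamma> - ?p)) \<longlongrightarrow> 0) (at 0)"
      using q by (intro tendsto_zero_powrI[where b = "\<gamma> - ?p"]) auto
    with lim have "((\<lambda>r. \<bar>f (t + r) - f t\<bar> / \<bar>r\<bar> powr \<gamma> * \<bar>r\<bar> powr (\<gamma> - ?p)) \<longlongrightarrow> 0) (at 0)"
      by (rule tendsto_mult_zero)
    moreover have "\<forall>\<^sub>F r in at 0. \<bar>f (t + r) - f t\<bar> / \<bar>r\<bar> powr \<gamma> * \<bar>r\<bar> powr (\<gamma> - ?p) = ?g r"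
      unfolding eventually_at_filter by (rule always_eventually) (simp add: powr_diff)
    ultimately show ?thesis
      by (rule Lim_transform_eventually)
  qed
  then have "isCont ?g 0"
    by (simp add: isCont_def)
  then have "(\<lambda>i. ?g (r i)) \<longlonglongrightarrow> ?g 0"
    using r by (rule isCont_tendsto_compose)
  moreover have "?g (r i) = (if \<bar>v i - t\<bar> \<le> 1 / real (Suc i) then \<bar>f (v i) - f t\<bar> / \<bar>v i - t\<bar> powr ?p else 0)" for i
    by (simp add: r_def)
  ultimately show False
    using nlim[of q] q by simp
qed

text \<open>Fubini in almost-sure form: the joint law is the product of the marginals, so the
  exceptional set is null as soon as almost all of its sections are. The inner quantifier runs over
  an independent copy \<open>\<omega>'\<close>, which is how conditioning on \<open>X\<close> is
  expressed.\<close>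

lemma (in prob_space) AE_indep_pairI:
  assumes indep: "indep_var S X T Y"
    and P [measurable]: "Measurable.pred (S \<Otimes>\<^sub>M T) (\<lambda>z. P (fst z) (snd z))"
    and AE: "AE \<omega> in M. AE \<omega>' in M. P (X \<omega>) (Y \<omega>')"
  shows "AE \<omega> in M. P (X \<omega>) (Y \<omega>)"
proof -
  have X [measurable]: "random_variable S X" and Y [measurable]: "random_variable T Y"
    and eq: "distr M S X \<Otimes>\<^sub>M distr M T Y = distr M (S \<Otimes>\<^sub>M T) (\<lambda>x. (X x, Y x))"
    using indep unfolding indep_var_distribution_eq by auto
  interpret Y: prob_space "distr M T Y"
    using Y by (rule prob_space_distr)
  define B where "B = {z \<in> space (S \<Otimes>\<^sub>M T). \<not> P (fst z) (snd z)}"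
  have B: "B \<in> sets (S \<Otimes>\<^sub>M T)"
    unfolding B_def by measurable
  have B': "B \<in> sets (distr M S X \<Otimes>\<^sub>M distr M T Y)" "B \<in> sets (S \<Otimes>\<^sub>M distr M T Y)"
    using B by (simp_all cong: sets_pair_measure_cong)
  have "emeasure (distr M (S \<Otimes>\<^sub>M T) (\<lambda>x. (X x, Y x))) B = (\<integral>\<^sup>+x. emeasure (distr M T Y) (Pair x -` B) \<partial>distr M S X)"
    unfolding eq[symmetric] by (rule Y.emeasure_pair_measure_alt[OF B'(1)])
  also have "\<dots> = (\<integral>\<^sup>+\<omega>. emeasure (distr M T Y) (Pair (X \<omega>) -` B) \<partial>M)"
    by (rule nn_integral_distr[OF X]) (use Y.measurable_emeasure_Pair[OF B'(2)] in simp)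
  also have "\<dots> = (\<integral>\<^sup>+\<omega>. 0 \<partial>M)"
  proof (rule nn_integral_cong_AE)
    show "AE \<omega> in M. emeasure (distr M T Y) (Pair (X \<omega>) -` B) = 0"
      using AE
    proof eventually_elim
      fix \<omega>
      assume "AE \<omega>' in M. P (X \<omega>) (Y \<omega>')"
      then have ae: "AE \<omega>' in M. Y \<omega>' \<notin> Pair (X \<omega>) -` B"
        by eventually_elim (simp add: B_def)
      have PB: "Pair (X \<omega>) -` B \<in> sets T"
        using B by (rule sets_Pair1)
      have "emeasure (distr M T Y) (Pair (X \<omega>) -` B) = emeasure M (Y -` (Pair (X \<omega>) -` B) \<inter> space M)"
        using PB by (rule emeasure_distr[OF Y])
      also have "Y -` (Pair (X \<omega>) -` B) \<inter> space M = {\<omega>' \<in> space M. Y \<omega>' \<in> Pair (X \<omega>) -` B}"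
        by auto
      also have "emeasure M \<dots> = 0"
        using ae by (rule emeasure_eq_0_AE)
      finally show "emeasure (distr M T Y) (Pair (X \<omega>) -` B) = 0" .
    qed
  qed
  finally have "emeasure (distr M (S \<Otimes>\<^sub>M T) (\<lambda>x. (X x, Y x))) B = 0"
    by simp
  then have "AE z in distr M (S \<Otimes>\<^sub>M T) (\<lambda>x. (X x, Y x)). P (fst z) (snd z)"
    using B by (intro AE_I[of _ _ B]) (auto simp: B_def)
  then have "AE \<omega> in M. P (fst (X \<omega>, Y \<omega>)) (snd (X \<omega>, Y \<omega>))"
    by (rule AE_distrD[rotated]) measurable
  then show ?thesis
    by simp
qed

theorem theorem4:
  fixes M :: "'a measure"
    and \<alpha> H :: "real \<Rightarrow> real" and c d :: real
    and \<Gamma> V \<gamma> :: "nat \<Rightarrow> 'a \<Rightarrow> real"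
  assumes "prob_space M"
    and "prob_space.lmmm_driving_sequences M \<Gamma> V \<gamma>"
    and "{c..d} \<subseteq> {0<..<2}"
    and "\<And>u. \<alpha> u \<in> {c..d}"
    and "\<And>u. H u \<in> {0<..<1}"
    and "\<alpha> C1_differentiable_on UNIV"
    and "H C1_differentiable_on UNIV"
    and "\<And>u. H u - 1 / \<alpha> u \<ge> 0"
  shows "\<forall>t. AE \<omega> in M. pointwise_holder_exponent (\<lambda>s. lmmm \<alpha> H \<Gamma> V \<gamma> s \<omega>) t \<le> ereal (H t)"
proof
  fix t :: real
  interpret prob_space M
    by fact
  obtain N where N: "poisson_process 1 N" "\<Gamma> = arrival_time N"
    using assms(2) unfolding lmmm_driving_sequences_def by blast
  have V: "indep_vars (\<lambda>_. borel) V UNIV" "\<And>i. distributed M lborel (V i) (\<lambda>x. ennreal (m_hat_density x))"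
    and \<gamma>: "indep_vars (\<lambda>_. borel) \<gamma> UNIV"
      "\<And>i. prob {\<omega> \<in> space M. \<gamma> i \<omega> = 1} = 1 / 2 \<and> prob {\<omega> \<in> space M. \<gamma> i \<omega> = - 1} = 1 / 2"
    and indep: "indep_vars (\<lambda>_. \<Pi>\<^sub>M i\<in>UNIV. borel)
       (\<lambda>k \<omega>. ([\<lambda>i. \<Gamma> i \<omega>, \<lambda>i. V i \<omega>, \<lambda>i. \<gamma> i \<omega>] ! k)) {..<3}"
    using assms(2) unfolding lmmm_driving_sequences_def by blast+
  define A where "A u = 1 / \<alpha> u" for u
  define b where "b u = H u - 1 / \<alpha> u" for u
  define K where "K u = stable_const (\<alpha> u) powr A u" for u
  have \<alpha>02: "0 < \<alpha> u" "\<alpha> u < 2" for u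
    using assms(3) assms(4)[of u] by auto
  have H1: "H u < 1" for u
    using assms(5)[of u] by simp
  \<comment> \<open>Only non-negativity of \<open>H - 1 / \<alpha>\<close> and
    \<open>H u < 1\<close> enter; the stable constant is then a positive absolutely convergent
    integral, inverted.\<close>
  have \<alpha>1: "1 < \<alpha> u" for u
  proof -
    have "1 / \<alpha> u < 1"
      using assms(8)[of u] H1[of u] by linarith
    then show ?thesis
      using \<alpha>02[of u] by simp
  qed
  have lip_\<alpha>: "lip_at \<alpha> u" and lip_H: "lip_at H u" for u
    using assms(6,7) by (auto simp: C1_differentiable_on_eq real_differentiable_def intro: lip_at_DERIV)
  have lip_A: "lip_at A u" for u
    unfolding A_def[abs_def] using lip_at_inverse[OF lip_\<alpha>[of u]] \<alpha>02[of u] by (simp add: inverse_eq_divide)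
  have lip_b: "lip_at b u" for u
    using lip_at_diff[OF lip_H lip_A, of u] by (simp add: A_def b_def[abs_def])
  have lip_K: "lip_at K u" for u
    unfolding K_def[abs_def] using \<alpha>1[of u] \<alpha>02[of u]
    by (intro lip_at_powr lip_at_compose[OF lip_\<alpha> lip_at_stable_const] lip_A stable_const_pos) auto
  have K_pos: "0 < K u" for u
    using stable_const_pos[OF \<alpha>1 \<alpha>02(2), of u] by (simp add: K_def)
  have Ab: "1 / 2 < A u" "0 \<le> b u" "A u + b u < 1" for u
    using \<alpha>02[of u] assms(8)[of u] H1[of u] by (auto simp: A_def b_def field_simps)
  \<comment> \<open>Being Lipschitz at each point gives continuity, hence Borel measurability, which
    is needed because the locations are inserted as arguments of these functions.\<close>
  have [measurable]: "A \<in> borel_measurable borel" "b \<in> borel_measurable borel" "K \<in> borel_measurable borel"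
    by (intro borel_measurable_continuous_onI continuous_at_imp_continuous_on ballI lip_at_isCont lip_A lip_b lip_K)+
  define Z where "Z g v \<omega> s = K s * (\<Sum>k. \<omega> k * kernel A b (g k) (v k) s)" for g v \<omega> :: "nat \<Rightarrow> real" and s
  \<comment> \<open>A statement about one countable sequence, hence jointly measurable in the three
    driving sequences as Fubini requires; a limit along all real \<open>r\<close> would not be
    visibly so.\<close>
  define Q where "Q q g v \<omega> \<longleftrightarrow> \<not> (\<lambda>i. if \<bar>v i - t\<bar> \<le> 1 / real (Suc i)
    then \<bar>Z g v \<omega> (v i) - Z g v \<omega> t\<bar> / \<bar>v i - t\<bar> powr real_of_rat q else 0) \<longlonglongrightarrow> 0"
    for q and g v \<omega> :: "nat \<Rightarrow> real"
  let ?S = "\<Pi>\<^sub>M i\<in>(UNIV::nat set). (borel :: real measure)"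
  \<comment> \<open>The three driving sequences are grouped into arrival times with locations,
    indices 0 and 1, and signs, index 2; the two groups are independent.\<close>
  let ?X = "\<lambda>J \<omega>. \<lambda>k\<in>J. [\<lambda>i. \<Gamma> i \<omega>, \<lambda>i. V i \<omega>, \<lambda>i. \<gamma> i \<omega>] ! k"
  let ?P = "PiM {0, 1} (\<lambda>_. ?S) \<Otimes>\<^sub>M PiM {2} (\<lambda>_. ?S)"
  have Q: "Measurable.pred ?P (\<lambda>z. Q q (fst z 0) (fst z 1) (snd z 2))" for q
  proof -
    have 0: "(\<lambda>z. fst z 0) \<in> ?P \<rightarrow>\<^sub>M ?S" and 1: "(\<lambda>z. fst z 1) \<in> ?P \<rightarrow>\<^sub>M ?S" and 2: "(\<lambda>z. snd z 2) \<in> ?P \<rightarrow>\<^sub>M ?S"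
      by (rule measurable_compose[OF measurable_fst measurable_component_singleton] measurable_compose[OF measurable_snd measurable_component_singleton], simp)+
    have [measurable]: "(\<lambda>z. fst z 0 i) \<in> borel_measurable ?P" "(\<lambda>z. fst z 1 i) \<in> borel_measurable ?P"
      "(\<lambda>z. snd z 2 i) \<in> borel_measurable ?P" for i
      using measurable_compose[OF 0 measurable_component_singleton[of i]]
        measurable_compose[OF 1 measurable_component_singleton[of i]]
        measurable_compose[OF 2 measurable_component_singleton[of i]] by simp_all
    show ?thesis
      unfolding Q_def Z_def by measurable
  qed
  have ind: "indep_var (PiM {0, 1} (\<lambda>_. ?S)) (?X {0, 1}) (PiM {2} (\<lambda>_. ?S)) (?X {2})"
    by (rule indep_var_restrict[OF indep]) auto
  have \<gamma>_meas: "(\<lambda>\<omega> i. \<gamma> i \<omega>) \<in> M \<rightarrow>\<^sub>M ?S"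
    using \<gamma>(1) by (intro measurable_PiM_single') (auto simp: indep_vars_def2)
  have "AE \<omega> in M. Q q (\<lambda>i. \<Gamma> i \<omega>) (\<lambda>i. V i \<omega>) (\<lambda>i. \<gamma> i \<omega>)"
    if q: "H t < real_of_rat q" "real_of_rat q < 1" for q
  proof -
    have "AE \<omega> in M. \<forall>i. V i \<omega> \<noteq> 0" "AE \<omega> in M. \<forall>i. V i \<omega> \<noteq> t"
      unfolding AE_all_countable using m_hat_AE_neq[OF V(2)] by blast+
    moreover have "AE \<omega> in M. \<forall>n. summable (\<lambda>i. real (Suc i) powr (- (1 + 1 / real (Suc n))) * (1 + \<bar>V i \<omega>\<bar>) powr (1 - 1 / real (Suc n)))"
      unfolding AE_all_countable by (intro allI AE_m_hat_summable V(2)) auto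
    moreover note AE_m_hat_infinitely_often_near[OF V(2,1), of t] AE_arrival_time_bounds[OF N(1)]
    ultimately have "AE \<omega> in M. AE \<omega>' in M. Q q (\<lambda>i. \<Gamma> i \<omega>) (\<lambda>i. V i \<omega>) (\<lambda>i. \<gamma> i \<omega>')"
    proof eventually_elim
      fix \<omega>
      assume V_neq: "\<forall>i. V i \<omega> \<noteq> 0" "\<forall>i. V i \<omega> \<noteq> t"
        and V_sum: "\<forall>n. summable (\<lambda>i. real (Suc i) powr (- (1 + 1 / real (Suc n))) * (1 + \<bar>V i \<omega>\<bar>) powr (1 - 1 / real (Suc n)))"
        and V_near: "\<exists>\<^sub>\<infinity>i. \<bar>V i \<omega> - t\<bar> \<le> 1 / real (Suc i)"
        and \<Gamma>: "\<forall>\<^sub>F i in sequentially. real (Suc i) / 2 \<le> arrival_time N i \<omega> \<and> arrival_time N i \<omega> \<le> 2 * real (Suc i)"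
      have Hq: "A t + b t < real_of_rat q"
        using q by (simp add: A_def b_def)
      have "AE y in coins. Q q (\<lambda>i. \<Gamma> i \<omega>) (\<lambda>i. V i \<omega>) y"
        unfolding Q_def Z_def N(2)
        by (rule AE_coins_kernel_series_not_little_o[OF lip_A lip_b lip_K K_pos Ab \<Gamma> V_neq[rule_format] V_sum[rule_format] V_near Hq q(2)])
      then have "AE y in distr M ?S (\<lambda>\<omega> i. \<gamma> i \<omega>). Q q (\<lambda>i. \<Gamma> i \<omega>) (\<lambda>i. V i \<omega>) y"
        by (simp only: distr_coins[OF \<gamma>])
      then show "AE \<omega>' in M. Q q (\<lambda>i. \<Gamma> i \<omega>) (\<lambda>i. V i \<omega>) (\<lambda>i. \<gamma> i \<omega>')"
        by (rule AE_distrD[OF \<gamma>_meas])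
    qed
    then show ?thesis
      using AE_indep_pairI[OF ind Q[of q]] by simp
  qed
  then have "AE \<omega> in M. \<forall>q. H t < real_of_rat q \<longrightarrow> real_of_rat q < 1 \<longrightarrow>
      Q q (\<lambda>i. \<Gamma> i \<omega>) (\<lambda>i. V i \<omega>) (\<lambda>i. \<gamma> i \<omega>)"
    unfolding AE_all_countable by (intro allI) auto
  then show "AE \<omega> in M. pointwise_holder_exponent (\<lambda>s. lmmm \<alpha> H \<Gamma> V \<gamma> s \<omega>) t \<le> ereal (H t)"
  proof eventually_elim
    fix \<omega>
    assume *: "\<forall>q. H t < real_of_rat q \<longrightarrow> real_of_rat q < 1 \<longrightarrow> Q q (\<lambda>i. \<Gamma> i \<omega>) (\<lambda>i. V i \<omega>) (\<lambda>i. \<gamma> i \<omega>)"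
    have Z: "lmmm \<alpha> H \<Gamma> V \<gamma> s \<omega> = Z (\<lambda>i. \<Gamma> i \<omega>) (\<lambda>i. V i \<omega>) (\<lambda>i. \<gamma> i \<omega>) s" for s
      by (simp add: lmmm_eq_kernel_series Z_def K_def A_def[abs_def] b_def[abs_def])
    show "pointwise_holder_exponent (\<lambda>s. lmmm \<alpha> H \<Gamma> V \<gamma> s \<omega>) t \<le> ereal (H t)"
    proof (rule pointwise_holder_exponent_leI[OF H1])
      fix q
      assume "H t < real_of_rat q" "real_of_rat q < 1"
      with * have "Q q (\<lambda>i. \<Gamma> i \<omega>) (\<lambda>i. V i \<omega>) (\<lambda>i. \<gamma> i \<omega>)"
        by blast
      then show "\<not> (\<lambda>i. if \<bar>V i \<omega> - t\<bar> \<le> 1 / real (Suc i)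
        then \<bar>lmmm \<alpha> H \<Gamma> V \<gamma> (V i \<omega>) \<omega> - lmmm \<alpha> H \<Gamma> V \<gamma> t \<omega>\<bar> / \<bar>V i \<omega> - t\<bar> powr real_of_rat q else 0) \<longlonglongrightarrow> 0"
        unfolding Q_def Z .
    qed
  qed
qed

end
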